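(* Let $\mathbb{F}$ be a field of characteristic zero and let $d\ge 5$ be an integer with $d\equiv 1\pmod 4$. Let $S=\{P_1,\ldots,P_d\}$ be a set of $d$ generic points in the projective plane $\mathbf{P}^2$ over $\mathbb{F}$, and let $V(2,d)$ be the $\mathbb{F}$-linear span of the cone polynomials of $S$. Then $$\dim_{\mathbb{F}} V(2,d)\le \binom{d+2}{2}-d-2.$$
   Context: $\mathbf{P}^2$ denotes the projective space of lines through the origin in $\mathbb{F}^{3}$. A statement about $d$ generic points $P_1,\ldots,P_d$ of $\mathbf{P}^2$ means: there is a nonempty Zariski-open subset $U\subseteq(\mathbf{P}^2)^d$ (depending on $d$) such that the statement holds for all $(P_1,\ldots,P_d)\in U$. Cone polynomials: given $S=\{P_1,\ldots,P_d\}\subset\mathbf{P}^2$, choose a point $Q\in\mathbf{P}^2$, and for each $1\le i\le d$ choose a linear form $L_i\in\mathbb{F}[x_1,x_2,x_3]$ that vanishes at $P_i$ and at $Q$. The product $\prod_{i=1}^d L_i$ is called a cone polynomial of $S$. The set of cone polynomials consists of all products obtained in this way over all choices of $Q$ and of the $L_i$. The space $V(2,d)$ is the $\mathbb{F}$-linear span of all cone polynomials of $S$, inside the space of homogeneous polynomials of degree $d$ in $x_1,x_2,x_3$. *)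

theory Defs
  imports "HOL-Analysis.Analysis" "HOL-Library.Poly_Mapping"
begin

text \<open>
  Multivariate polynomials in variables indexed by a type \<open>'x\<close> are the monoid ring
  \<open>('x \<Rightarrow>\<^sub>0 nat) \<Rightarrow>\<^sub>0 'a\<close>: finitely supported maps from exponent vectors to coefficients,
  with the convolution product of \<open>Poly_Mapping\<close>.
\<close>

type_synonym ('x, 'a) mpol = "('x \<Rightarrow>\<^sub>0 nat) \<Rightarrow>\<^sub>0 'a"

definition mp_smult :: "'a::comm_semiring_1 \<Rightarrow> ('x, 'a) mpol \<Rightarrow> ('x, 'a) mpol" where
  "mp_smult c p = Poly_Mapping.map ((*) c) p"

lemma lookup_mp_smult:
  "Poly_Mapping.lookup (mp_smult c p) m = c * Poly_Mapping.lookup p m"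
  by (simp add: mp_smult_def Poly_Mapping.map.rep_eq when_def)

global_interpretation mp: vector_space "mp_smult :: 'a::field \<Rightarrow> ('x, 'a) mpol \<Rightarrow> ('x, 'a) mpol"
proof
  fix a b :: 'a and x y :: "('x, 'a) mpol"
  show "mp_smult a (x + y) = mp_smult a x + mp_smult a y"
    by (rule poly_mapping_eqI) (simp add: lookup_mp_smult lookup_add distrib_left)
  show "mp_smult (a + b) x = mp_smult a x + mp_smult b x"
    by (rule poly_mapping_eqI) (simp add: lookup_mp_smult lookup_add distrib_right)
  show "mp_smult a (mp_smult b x) = mp_smult (a * b) x"
    by (rule poly_mapping_eqI) (simp add: lookup_mp_smult mult.assoc)
  show "mp_smult 1 x = x"
    by (rule poly_mapping_eqI) (simp add: lookup_mp_smult)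
qed

definition mp_eval :: "('x \<Rightarrow> 'a::comm_semiring_1) \<Rightarrow> ('x, 'a) mpol \<Rightarrow> 'a" where
  "mp_eval v p = (\<Sum>m\<in>Poly_Mapping.keys p.
     Poly_Mapping.lookup p m * (\<Prod>x\<in>Poly_Mapping.keys m. v x ^ Poly_Mapping.lookup m x))"

text \<open>The zero polynomial is homogeneous of every degree.\<close>

definition mp_homogeneous :: "nat \<Rightarrow> ('x, 'a::zero) mpol \<Rightarrow> bool" where
  "mp_homogeneous n p \<longleftrightarrow> (\<forall>m\<in>Poly_Mapping.keys p.
     (\<Sum>x\<in>Poly_Mapping.keys m. Poly_Mapping.lookup m x) = n)"


definition proj_plane :: "('a::field ^ 3) set set" where
  "proj_plane = {L. vec.subspace L \<and> vec.dim L = 1}"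

definition linear_form :: "(3, 'a::field) mpol \<Rightarrow> bool" where
  "linear_form l \<longleftrightarrow> mp_homogeneous 1 l"

definition vanishes_at :: "(3, 'a::field) mpol \<Rightarrow> ('a ^ 3) set \<Rightarrow> bool" where
  "vanishes_at p L \<longleftrightarrow> (\<forall>v\<in>L. v \<noteq> 0 \<longrightarrow> mp_eval (($) v) p = 0)"


text \<open>
  Ordered \<open>d\<close>-tuples of points of the plane are extensional functions on \<open>{1..d}\<close>.
  Zariski-closed sets of tuples are the zero loci of sets of multihomogeneous polynomials
  in \<open>d\<close> groups of three variables; the variable \<open>(i, j)\<close> is the \<open>j\<close>-th
  homogeneous coordinate of the \<open>i\<close>-th point.
\<close>

definition plane_tuples :: "nat \<Rightarrow> (nat \<Rightarrow> ('a::field ^ 3) set) set" where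
  "plane_tuples d = {1..d} \<rightarrow>\<^sub>E proj_plane"

definition multihomogeneous :: "nat \<Rightarrow> (nat \<times> 3, 'a::zero) mpol \<Rightarrow> bool" where
  "multihomogeneous d f \<longleftrightarrow> (\<exists>e :: nat \<Rightarrow> nat. \<forall>m\<in>Poly_Mapping.keys f.
     Poly_Mapping.keys m \<subseteq> {1..d} \<times> UNIV \<and>
     (\<forall>i\<in>{1..d}. (\<Sum>j\<in>UNIV. Poly_Mapping.lookup m (i, j)) = e i))"

definition vanishes_at_tuple ::
  "nat \<Rightarrow> (nat \<times> 3, 'a::field) mpol \<Rightarrow> (nat \<Rightarrow> ('a ^ 3) set) \<Rightarrow> bool" where
  "vanishes_at_tuple d f P \<longleftrightarrow> (\<forall>v :: nat \<Rightarrow> 'a ^ 3.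
     (\<forall>i\<in>{1..d}. v i \<in> P i \<and> v i \<noteq> 0) \<longrightarrow> mp_eval (\<lambda>(i, j). v i $ j) f = 0)"

definition zariski_closed :: "nat \<Rightarrow> (nat \<Rightarrow> ('a::field ^ 3) set) set \<Rightarrow> bool" where
  "zariski_closed d Z \<longleftrightarrow> (\<exists>A. (\<forall>f\<in>A. multihomogeneous d f) \<and>
     Z = {P \<in> plane_tuples d. \<forall>f\<in>A. vanishes_at_tuple d f P})"

definition zariski_open :: "nat \<Rightarrow> (nat \<Rightarrow> ('a::field ^ 3) set) set \<Rightarrow> bool" where
  "zariski_open d U \<longleftrightarrow> U \<subseteq> plane_tuples d \<and> zariski_closed d (plane_tuples d - U)"

definition holds_generically ::
  "nat \<Rightarrow> ((nat \<Rightarrow> ('a::field ^ 3) set) \<Rightarrow> bool) \<Rightarrow> bool" where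
  "holds_generically d \<Phi> \<longleftrightarrow> (\<exists>U. zariski_open d U \<and> U \<noteq> {} \<and> (\<forall>P\<in>U. \<Phi> P))"


definition cone_polynomials ::
  "nat \<Rightarrow> (nat \<Rightarrow> ('a::field ^ 3) set) \<Rightarrow> (3, 'a) mpol set" where
  "cone_polynomials d P = {\<Prod>i\<in>{1..d}. L i | Q L. Q \<in> proj_plane \<and>
     (\<forall>i\<in>{1..d}. linear_form (L i) \<and> vanishes_at (L i) (P i) \<and> vanishes_at (L i) Q)}"

definition cone_space ::
  "nat \<Rightarrow> (nat \<Rightarrow> ('a::field ^ 3) set) \<Rightarrow> (3, 'a) mpol set" where
  "cone_space d P = mp.span (cone_polynomials d P)"


text \<open>
  \<open>mp.dim\<close> is the cardinality of a basis, hence 0 for infinite-dimensional spaces. The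
  following shows that \<open>cone_space\<close> lies in the finite-dimensional space of forms of degree
  \<open>d\<close>, so this convention is harmless.
\<close>

lemma mp_homogeneous_alt:
  fixes p :: "('x::finite, 'a::zero) mpol"
  shows "mp_homogeneous n p \<longleftrightarrow>
    (\<forall>m\<in>Poly_Mapping.keys p. (\<Sum>x\<in>UNIV. Poly_Mapping.lookup m x) = n)"
proof -
  have "(\<Sum>x\<in>Poly_Mapping.keys m. Poly_Mapping.lookup m x) = (\<Sum>x\<in>UNIV. Poly_Mapping.lookup m x)"
    for m :: "'x \<Rightarrow>\<^sub>0 nat"
    by (intro sum.mono_neutral_left) (auto simp: in_keys_iff)
  then show ?thesis by (simp add: mp_homogeneous_def)
qed

lemma mp_homogeneous_mult:
  fixes p q :: "('x::finite, 'a::comm_semiring_1) mpol"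
  assumes "mp_homogeneous m p" "mp_homogeneous n q"
  shows "mp_homogeneous (m + n) (p * q)"
  unfolding mp_homogeneous_alt
proof
  fix k assume "k \<in> Poly_Mapping.keys (p * q)"
  with keys_mult[of p q] obtain a b where
    "a \<in> Poly_Mapping.keys p" "b \<in> Poly_Mapping.keys q" "k = a + b" by blast
  with assms show "(\<Sum>x\<in>UNIV. Poly_Mapping.lookup k x) = m + n"
    by (simp add: mp_homogeneous_alt lookup_add sum.distrib)
qed

lemma mp_homogeneous_prod:
  fixes f :: "'i \<Rightarrow> ('x::finite, 'a::comm_semiring_1) mpol"
  assumes "finite I" "\<And>i. i \<in> I \<Longrightarrow> mp_homogeneous 1 (f i)"
  shows "mp_homogeneous (card I) (\<Prod>i\<in>I. f i)"
  using assms
proof (induction I rule: finite_induct)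
  case empty
  then show ?case by (simp add: mp_homogeneous_def)
next
  case (insert i I)
  then show ?case using mp_homogeneous_mult[of 1 "f i" "card I" "\<Prod>i\<in>I. f i"] by simp
qed

lemma subspace_mp_homogeneous:
  "mp.subspace {p :: ('x::finite, 'a::field) mpol. mp_homogeneous n p}"
  by (rule mp.subspaceI)
    (auto simp: mp_homogeneous_def in_keys_iff lookup_add lookup_mp_smult)

lemma cone_space_homogeneous: "cone_space d P \<subseteq> {p. mp_homogeneous d p}"
  unfolding cone_space_def
proof (rule mp.span_minimal[OF _ subspace_mp_homogeneous])
  show "cone_polynomials d P \<subseteq> {p. mp_homogeneous d p}"
  proof
    fix p assume "p \<in> cone_polynomials d P"
    then obtain L where "p = (\<Prod>i\<in>{1..d}. L i)" "\<forall>i\<in>{1..d}. mp_homogeneous 1 (L i)"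
      by (auto simp: cone_polynomials_def linear_form_def)
    then show "p \<in> {p. mp_homogeneous d p}" using mp_homogeneous_prod[of "{1..d}" L] by simp
  qed
qed

lemma mp_homogeneous_finite_dim:
  "\<exists>B. finite B \<and> {p :: ('x::finite, 'a::field) mpol. mp_homogeneous n p} \<subseteq> mp.span B"
proof (intro exI conjI)
  let ?M = "{m :: 'x \<Rightarrow>\<^sub>0 nat. (\<Sum>x\<in>UNIV. Poly_Mapping.lookup m x) = n}"
  let ?mon = "\<lambda>m. Poly_Mapping.single m (1 :: 'a)"
  have "Poly_Mapping.lookup m \<in> UNIV \<rightarrow>\<^sub>E {..n}" if "m \<in> ?M" for m
    using that member_le_sum[of _ UNIV "Poly_Mapping.lookup m"] by (auto simp: PiE_iff)
  then have "Poly_Mapping.lookup ` ?M \<subseteq> UNIV \<rightarrow>\<^sub>E {..n}" by blast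
  then have "finite (Poly_Mapping.lookup ` ?M)"
    by (rule finite_subset) (intro finite_PiE; simp)
  then have "finite ?M"
    by (rule finite_imageD) (simp add: inj_on_def poly_mapping.lookup_inject)
  then show "finite (?mon ` ?M)" by (rule finite_imageI)
  show "{p :: ('x, 'a) mpol. mp_homogeneous n p} \<subseteq> mp.span (?mon ` ?M)"
  proof
    fix p :: "('x, 'a) mpol" assume "p \<in> {p. mp_homogeneous n p}"
    then have keys: "Poly_Mapping.keys p \<subseteq> ?M" by (auto simp: mp_homogeneous_alt)
    have "p = (\<Sum>m\<in>Poly_Mapping.keys p. mp_smult (Poly_Mapping.lookup p m) (?mon m))"
      by (intro poly_mapping_eqI)
        (simp add: lookup_sum lookup_mp_smult lookup_single when_def if_distrib[of "(*) _"] in_keys_iff cong: if_cong)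
    also have "\<dots> \<in> mp.span (?mon ` ?M)"
      using keys by (intro mp.span_sum mp.span_scale mp.span_base) auto
    finally show "p \<in> mp.span (?mon ` ?M)" .
  qed
qed

end

theory Submission
  imports Defs
begin

text \<open>
  Choose representatives \<open>v\<^sub>i\<close> of the points. For general \<open>q\<close> the cone polynomial with vertex \<open>q\<close> is
  \<open>F\<^sub>q(x) = \<Prod>\<^sub>i det(x, v\<^sub>i, q)\<close> up to scaling; the cones whose vertex is one of the points are
  limits of these and lie in their span. For odd \<open>d\<close> the form \<open>(x, q) \<mapsto> F\<^sub>q(x)\<close> is alternating, so
  the span has even dimension. It is annihilated by the \<open>d\<close> evaluations at the points and by one more
  functional, the full polarization at \<open>(v\<^sub>1, \<dots>, v\<^sub>d)\<close>: its value on \<open>F\<^sub>q\<close> is the permanent of the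
  skew-symmetric matrix \<open>det(v\<^sub>i, v\<^sub>j, q)\<close> of odd size, which vanishes. These \<open>d + 1\<close> functionals are
  independent for general points, so the dimension is at most \<open>N = binomial(d + 2, 2) - d - 1\<close>. For
  \<open>d \<equiv> 1 (mod 4)\<close> the number \<open>N\<close> is odd, and parity improves the bound by one.
\<close>

section \<open>Evaluation of polynomials\<close>

lemma monomial_eval_superset:
  fixes v :: "'x \<Rightarrow> 'a::comm_semiring_1"
  assumes "finite S" "Poly_Mapping.keys m \<subseteq> S"
  shows "(\<Prod>x\<in>Poly_Mapping.keys m. v x ^ Poly_Mapping.lookup m x) = (\<Prod>x\<in>S. v x ^ Poly_Mapping.lookup m x)"
  using assms by (intro prod.mono_neutral_left) (auto simp: in_keys_iff)

lemma monomial_eval_add: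
  fixes v :: "'x \<Rightarrow> 'a::comm_semiring_1"
  shows "(\<Prod>x\<in>Poly_Mapping.keys (m + n). v x ^ Poly_Mapping.lookup (m + n) x) =
    (\<Prod>x\<in>Poly_Mapping.keys m. v x ^ Poly_Mapping.lookup m x) *
    (\<Prod>x\<in>Poly_Mapping.keys n. v x ^ Poly_Mapping.lookup n x)"
proof -
  let ?S = "Poly_Mapping.keys m \<union> Poly_Mapping.keys n"
  have "finite ?S" by simp
  moreover have "Poly_Mapping.keys (m + n) \<subseteq> ?S" by (rule keys_add)
  ultimately show ?thesis
    unfolding monomial_eval_superset[of ?S "m + n", OF \<open>finite ?S\<close> keys_add]
    by (simp add: monomial_eval_superset[of ?S m] monomial_eval_superset[of ?S n]
        lookup_add power_add prod.distrib)
qed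

lemma mp_eval_superset:
  assumes "finite S" "Poly_Mapping.keys p \<subseteq> S"
  shows "mp_eval v p = (\<Sum>m\<in>S. Poly_Mapping.lookup p m *
    (\<Prod>x\<in>Poly_Mapping.keys m. v x ^ Poly_Mapping.lookup m x))"
  unfolding mp_eval_def using assms by (intro sum.mono_neutral_left) (auto simp: in_keys_iff)

lemma mp_eval_0 [simp]: "mp_eval v 0 = 0"
  by (simp add: mp_eval_def)

lemma mp_eval_single:
  "mp_eval v (Poly_Mapping.single m c) = c * (\<Prod>x\<in>Poly_Mapping.keys m. v x ^ Poly_Mapping.lookup m x)"
  by (simp add: mp_eval_superset[of "{m}"])

lemma mp_eval_1 [simp]: "mp_eval v 1 = 1"
  using mp_eval_single[of v 0 1] by simp

lemma mp_eval_add: "mp_eval v (p + q) = mp_eval v p + mp_eval v q"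
proof -
  let ?S = "Poly_Mapping.keys p \<union> Poly_Mapping.keys q"
  have "finite ?S" by simp
  moreover have "Poly_Mapping.keys (p + q) \<subseteq> ?S" by (rule keys_add)
  ultimately show ?thesis
    by (simp add: mp_eval_superset[of ?S] lookup_add distrib_right sum.distrib)
qed

lemma mp_eval_smult: "mp_eval v (mp_smult c p) = c * mp_eval v p"
proof -
  have "Poly_Mapping.keys (mp_smult c p) \<subseteq> Poly_Mapping.keys p"
    by (auto simp: in_keys_iff lookup_mp_smult)
  then show ?thesis
    by (simp add: mp_eval_superset[of "Poly_Mapping.keys p"] lookup_mp_smult sum_distrib_left mult.assoc)
qed

lemma mp_eval_sum: "mp_eval v (\<Sum>i\<in>I. p i) = (\<Sum>i\<in>I. mp_eval v (p i))"
  by (induction I rule: infinite_finite_induct) (simp_all add: mp_eval_add)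

lemma sum_single_lookup:
  "(\<Sum>m\<in>Poly_Mapping.keys p. Poly_Mapping.single m (Poly_Mapping.lookup p m)) = p"
  by (rule poly_mapping_eqI) (simp add: lookup_sum lookup_single when_def in_keys_iff)

lemma mp_eval_mult: "mp_eval v (p * q) = mp_eval v p * mp_eval v q"
proof -
  let ?t = "\<lambda>p m. Poly_Mapping.single m (Poly_Mapping.lookup p m)"
  have "mp_eval v (?t p m * ?t q n) = mp_eval v (?t p m) * mp_eval v (?t q n)" for m n
    by (simp add: mult_single mp_eval_single monomial_eval_add ac_simps)
  then have "mp_eval v ((\<Sum>m\<in>Poly_Mapping.keys p. ?t p m) * (\<Sum>n\<in>Poly_Mapping.keys q. ?t q n)) =
    mp_eval v (\<Sum>m\<in>Poly_Mapping.keys p. ?t p m) * mp_eval v (\<Sum>n\<in>Poly_Mapping.keys q. ?t q n)"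
    by (simp add: sum_product mp_eval_sum)
  then show ?thesis by (simp add: sum_single_lookup)
qed

lemma mp_eval_prod: "mp_eval v (\<Prod>i\<in>I. p i) = (\<Prod>i\<in>I. mp_eval v (p i))"
  by (induction I rule: infinite_finite_induct) (simp_all add: mp_eval_mult)

lemma mp_eval_diff:
  fixes p q :: "('x, 'a::comm_ring_1) mpol"
  shows "mp_eval v (p - q) = mp_eval v p - mp_eval v q"
  using mp_eval_add[of v "p - q" q] by simp

lemma prod_3: "(\<Prod>k\<in>UNIV. f k) = f 1 * f 2 * f (3::3)"
  unfolding UNIV_3 by (simp add: mult.assoc)

text \<open>Kronecker substitution: \<open>x\<^sub>k \<mapsto> t^(N^k)\<close> separates the monomials with exponents below \<open>N\<close>.\<close>

lemma mp_eval_eq_0_imp: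
  fixes p :: "(3, 'a::field_char_0) mpol"
  assumes "\<And>v :: 'a ^ 3. mp_eval (($) v) p = 0"
  shows "p = 0"
proof -
  let ?l = "Poly_Mapping.lookup :: (3 \<Rightarrow>\<^sub>0 nat) \<Rightarrow> _"
  \<comment> \<open>Exceeds the sum of all exponents that occur, hence every single
    exponent.\<close>
  define N where "N = Suc (\<Sum>m\<in>Poly_Mapping.keys p. \<Sum>k\<in>UNIV. ?l m k)"
  have bound: "?l m k < N" if "m \<in> Poly_Mapping.keys p" for m k
  proof -
    have "?l m k \<le> (\<Sum>k\<in>UNIV. ?l m k)" by (rule member_le_sum) simp_all
    also have "\<dots> \<le> (\<Sum>m\<in>Poly_Mapping.keys p. \<Sum>k\<in>UNIV. ?l m k)"
      by (rule member_le_sum[OF that, where f = "\<lambda>m. \<Sum>k\<in>UNIV. ?l m k"]) simp_all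
    finally show ?thesis unfolding N_def by (rule le_imp_less_Suc)
  qed
  define e where "e m = ?l m 1 + N * (?l m 2 + N * ?l m 3)" for m
  have inj: "m = n" if "m \<in> Poly_Mapping.keys p" "n \<in> Poly_Mapping.keys p" "e m = e n" for m n
  proof -
    \<comment> \<open>Uniqueness of base-\<open>N\<close> digits, applied twice to recover the three
      exponents from \<open>e\<close>.\<close>
    have digit: "a = b \<and> x = y" if "a < N" "b < N" "a + N * x = b + N * y" for a b x y
    proof
      have "a = (a + N * x) mod N" using that(1) by simp
      also have "\<dots> = b" unfolding that(3) using that(2) by simp
      finally show "a = b" .
      then show "x = y" using that by simp
    qed
    have 1: "?l m 1 = ?l n 1" and r: "?l m 2 + N * ?l m 3 = ?l n 2 + N * ?l n 3"
      using digit[OF bound[OF that(1)] bound[OF that(2)] that(3)[unfolded e_def]] by blast+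
    have 2: "?l m 2 = ?l n 2" and 3: "?l m 3 = ?l n 3"
      using digit[OF bound[OF that(1)] bound[OF that(2)] r] by blast+
    have "?l m k = ?l n k" for k using exhaust_3[of k] 1 2 3 by metis
    then show ?thesis by (intro poly_mapping_eqI)
  qed
  define P where "P = (\<Sum>m\<in>Poly_Mapping.keys p. Polynomial.monom (Poly_Mapping.lookup p m) (e m))"
  have "poly P t = 0" for t
  proof -
    define v :: "'a ^ 3" where "v = vector [t, t ^ N, t ^ (N * N)]"
    have "(\<Prod>x\<in>Poly_Mapping.keys m. v $ x ^ ?l m x) = t ^ e m" for m
    proof -
      have "(\<Prod>x\<in>Poly_Mapping.keys m. v $ x ^ ?l m x) =
          t ^ ?l m 1 * (t ^ N) ^ ?l m 2 * (t ^ (N * N)) ^ ?l m 3"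
        unfolding monomial_eval_superset[of UNIV m, OF finite subset_UNIV]
        unfolding prod_3 v_def vector_3 ..
      also have "\<dots> = t ^ (?l m 1 + N * ?l m 2 + N * N * ?l m 3)"
        by (simp only: power_add power_mult)
      also have "\<dots> = t ^ e m"
        by (simp only: e_def distrib_left add.assoc mult.assoc)
      finally show ?thesis .
    qed
    then have "mp_eval (($) v) p = poly P t"
      by (simp add: mp_eval_def P_def poly_sum poly_monom)
    then show ?thesis using assms by simp
  qed
  \<comment> \<open>A univariate polynomial that vanishes on an infinite field is zero; as
    \<open>e\<close> is injective on the keys of \<open>p\<close>, its coefficients are those of
    \<open>p\<close>.\<close>
  then have "P = 0" using poly_all_0_iff_0 by blast
  have "Poly_Mapping.lookup p m = 0" if m: "m \<in> Poly_Mapping.keys p" for m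
  proof -
    have e: "e n = e m \<longleftrightarrow> n = m" if "n \<in> Poly_Mapping.keys p" for n
      using inj[OF that m] by blast
    have "0 = coeff P (e m)" using \<open>P = 0\<close> by simp
    also have "\<dots> = (\<Sum>n\<in>Poly_Mapping.keys p. if n = m then Poly_Mapping.lookup p n else 0)"
      unfolding P_def coeff_sum by (intro sum.cong refl) (simp add: e)
    also have "\<dots> = Poly_Mapping.lookup p m" using m by simp
    finally show ?thesis by simp
  qed
  then have "Poly_Mapping.lookup p m = 0" for m unfolding in_keys_iff by blast
  then show ?thesis by (intro poly_mapping_eqI) simp
qed

section \<open>Skew-symmetric matrices and permanents\<close>

text \<open>Induction on the size: a nonzero entry \<open>M r s\<close> gives an invertible skew 2x2
  block, and eliminating it leaves a skew-symmetric matrix smaller by two, still of odd size. A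
  kernel vector of that matrix extends to one of \<open>M\<close>.\<close>

lemma skew_odd_kernel:
  fixes M :: "'i \<Rightarrow> 'i \<Rightarrow> 'a::field_char_0"
  assumes "finite I" "odd (card I)" "\<And>a b. a \<in> I \<Longrightarrow> b \<in> I \<Longrightarrow> M a b = - M b a"
  shows "\<exists>c. (\<exists>a\<in>I. c a \<noteq> 0) \<and> (\<forall>a\<in>I. (\<Sum>b\<in>I. M a b * c b) = 0)"
  using assms
proof (induction "card I" arbitrary: I M rule: less_induct)
  case less
  show ?case
  proof (cases "\<forall>a\<in>I. \<forall>b\<in>I. M a b = 0")
    case True
    moreover have "I \<noteq> {}" using less.prems(2) by auto
    ultimately show ?thesis by (intro exI[of _ "\<lambda>_. 1"]) auto
  next
    case False
    then obtain r s where rs: "r \<in> I" "s \<in> I" "M r s \<noteq> 0" by blast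
    have diag: "M a a = 0" if "a \<in> I" for a
    proof -
      have "2 * M a a = M a a + M a a" by (rule mult_2)
      also have "\<dots> = 0" by (subst less.prems(3)[OF that that]) simp
      finally show ?thesis by simp
    qed
    then have "r \<noteq> s" using rs by auto
    define J where "J = I - {r, s}"
    have I: "I = insert r (insert s J)" "r \<notin> J" "s \<notin> J" "finite J"
      using rs less.prems(1) by (auto simp: J_def)
    then have card: "card I = Suc (Suc (card J))" using \<open>r \<noteq> s\<close> by simp
    \<comment> \<open>The Schur complement of the block on \<open>{r, s}\<close>.\<close>
    define M' where "M' a b = M a b + (M a r * M s b - M a s * M r b) / M r s" for a b
    have skew: "M' a b = - M' b a" if "a \<in> J" "b \<in> J" for a b
    proof -
      have "a \<in> I" "b \<in> I" using that I by auto
      then have "M b r = - M r b" "M b s = - M s b" "M s a = - M a s" "M r a = - M a r" "M b a = - M a b"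
        using less.prems(3) rs by blast+
      then show ?thesis unfolding M'_def using rs(3)
        by (simp only:) (simp add: divide_simps algebra_simps)
    qed
    obtain c where c: "\<exists>a\<in>J. c a \<noteq> 0" "\<forall>a\<in>J. (\<Sum>b\<in>J. M' a b * c b) = 0"
      using less.hyps[of J M', OF _ _ _ skew] card I(4) less.prems(2) by auto
    define S where "S a = (\<Sum>b\<in>J. M a b * c b)" for a
    \<comment> \<open>The entries at \<open>r\<close> and \<open>s\<close> are those forced by rows
      \<open>s\<close> and \<open>r\<close> respectively.\<close>
    define c' where "c' = c(r := S s / M r s, s := - S r / M r s)"
    have row: "(\<Sum>b\<in>I. M a b * c' b) = M a r * (S s / M r s) - M a s * (S r / M r s) + S a" for a
    proof -
      have "(\<Sum>b\<in>J. M a b * c' b) = S a"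
        unfolding S_def by (rule sum.cong) (use I in \<open>auto simp: c'_def\<close>)
      then show ?thesis using I \<open>r \<noteq> s\<close> by (simp add: c'_def)
    qed
    have "M s r = - M r s" using less.prems(3) rs by blast
    then have "(\<Sum>b\<in>I. M r b * c' b) = 0" "(\<Sum>b\<in>I. M s b * c' b) = 0"
      unfolding row using diag rs by simp_all
    moreover have "(\<Sum>b\<in>I. M a b * c' b) = 0" if "a \<in> J" for a
    proof -
      have "0 = (\<Sum>b\<in>J. M' a b * c b)" using c that by simp
      also have "\<dots> = (\<Sum>b\<in>J. M a b * c b + M a r / M r s * (M s b * c b) - M a s / M r s * (M r b * c b))"
        using rs(3) by (intro sum.cong) (simp_all add: M'_def divide_simps algebra_simps)
      also have "\<dots> = S a + M a r / M r s * S s - M a s / M r s * S r"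
        by (simp add: S_def sum.distrib sum_subtractf sum_distrib_left)
      finally show ?thesis unfolding row by (simp add: algebra_simps)
    qed
    moreover have "\<exists>a\<in>I. c' a \<noteq> 0" using c(1) I by (auto simp: c'_def)
    ultimately show ?thesis using I by (intro exI[of _ c']) auto
  qed
qed

text \<open>Ryser's formula: inclusion-exclusion over the columns isolates the bijective column choices.\<close>

lemma ryser:
  fixes m :: "'i \<Rightarrow> 'i \<Rightarrow> 'a::comm_ring_1"
  assumes "finite I"
  shows "(\<Sum>A\<in>Pow I. (-1) ^ card (I - A) * (\<Prod>j\<in>I. \<Sum>i\<in>A. m j i)) =
    (\<Sum>\<sigma> | \<sigma> permutes I. \<Prod>j\<in>I. m j (\<sigma> j))"
proof -
  let ?F = "I \<rightarrow>\<^sub>E I"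
  have fin: "finite ?F" by (intro finite_PiE assms)
  have "(\<Sum>A\<in>Pow I. (-1) ^ card (I - A) * (\<Prod>j\<in>I. \<Sum>i\<in>A. m j i)) =
      (\<Sum>A\<in>Pow I. \<Sum>f\<in>?F. if f ` I \<subseteq> A then (-1) ^ card (I - A) * (\<Prod>j\<in>I. m j (f j)) else 0)"
  proof (rule sum.cong[OF refl])
    fix A assume "A \<in> Pow I"
    then have A: "finite A" "A \<subseteq> I" using assms finite_subset by auto
    have "(\<Prod>j\<in>I. \<Sum>i\<in>A. m j i) = (\<Sum>f\<in>I \<rightarrow>\<^sub>E A. \<Prod>j\<in>I. m j (f j))"
      by (rule prod_sum_PiE) (use assms A in auto)
    also have "I \<rightarrow>\<^sub>E A = {f \<in> ?F. f ` I \<subseteq> A}"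
      using A by (auto simp: PiE_iff image_subset_iff extensional_def)
    finally show "(-1) ^ card (I - A) * (\<Prod>j\<in>I. \<Sum>i\<in>A. m j i) =
        (\<Sum>f\<in>?F. if f ` I \<subseteq> A then (-1) ^ card (I - A) * (\<Prod>j\<in>I. m j (f j)) else 0)"
      by (simp add: sum_distrib_left sum.inter_filter[OF fin] if_distrib[of "(*) _"] cong: if_cong)
  qed
  also have "\<dots> = (\<Sum>f\<in>?F. \<Sum>A\<in>Pow I. if f ` I \<subseteq> A then (-1) ^ card (I - A) * (\<Prod>j\<in>I. m j (f j)) else 0)"
    by (rule sum.swap)
  also have "\<dots> = (\<Sum>f\<in>?F. if f ` I = I then \<Prod>j\<in>I. m j (f j) else 0)"
  proof (rule sum.cong[OF refl])
    fix f assume f: "f \<in> ?F"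
    let ?c = "\<Prod>j\<in>I. m j (f j)"
    have fI: "f ` I \<subseteq> I" using f by auto
    have "(\<Sum>A\<in>Pow I. if f ` I \<subseteq> A then (-1) ^ card (I - A) * ?c else 0) =
        (\<Sum>A | A \<in> Pow I \<and> f ` I \<subseteq> A. (-1) ^ card (I - A) * ?c)"
      by (rule sum.inter_filter[symmetric]) (use assms in simp)
    also have "\<dots> = (\<Sum>B\<in>Pow (I - f ` I). (-1) ^ card B * ?c)"
      by (rule sum.reindex_bij_witness[of _ "\<lambda>B. I - B" "\<lambda>A. I - A"])
        (use fI in \<open>auto simp: double_diff\<close>)
    also have "\<dots> = (\<Sum>B\<in>Pow (I - f ` I). (-1) ^ card B) * ?c"
      by (simp add: sum_distrib_right)
    \<comment> \<open>The alternating sum over sets of columns missed by \<open>f\<close> is a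
      product of factors -1 + 1, so it vanishes unless no column is missed.\<close>
    also have "(\<Sum>B\<in>Pow (I - f ` I). (-1) ^ card B) = (\<Prod>i\<in>I - f ` I. (-1) + (1 :: 'a))"
      using assms by (subst prod_add) auto
    also have "\<dots> = (if f ` I = I then 1 else 0)"
    proof -
      have "I - f ` I = {} \<longleftrightarrow> f ` I = I" using fI by blast
      then show ?thesis using assms by (simp add: power_0_left)
    qed
    finally show "(\<Sum>A\<in>Pow I. if f ` I \<subseteq> A then (-1) ^ card (I - A) * ?c else 0) =
        (if f ` I = I then ?c else 0)" by simp
  qed
  also have "\<dots> = (\<Sum>f | f \<in> ?F \<and> f ` I = I. \<Prod>j\<in>I. m j (f j))"
    by (rule sum.inter_filter[symmetric, OF fin])
  also have "\<dots> = (\<Sum>\<sigma> | \<sigma> permutes I. \<Prod>j\<in>I. m j (\<sigma> j))"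
  \<comment> \<open>Surjective self-maps of a finite set are bijective; they become permutations by
    the identity outside \<open>I\<close>.\<close>
  proof (rule sum.reindex_bij_witness[of _ "\<lambda>\<sigma>. restrict \<sigma> I" "\<lambda>f i. if i \<in> I then f i else i"])
    fix f assume f: "f \<in> {f. f \<in> ?F \<and> f ` I = I}"
    show "restrict (\<lambda>i. if i \<in> I then f i else i) I = f"
      using f by (auto simp: fun_eq_iff PiE_iff extensional_def)
    have "inj_on f I" using f assms by (intro eq_card_imp_inj_on) auto
    then have "bij_betw (\<lambda>i. if i \<in> I then f i else i) I I"
      using f by (auto simp: bij_betw_def inj_on_def)
    then show "(\<lambda>i. if i \<in> I then f i else i) \<in> {\<sigma>. \<sigma> permutes I}"
      using bij_imp_permutes by force
  qed (auto simp: permutes_image permutes_in_image permutes_not_in fun_eq_iff)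
  finally show ?thesis .
qed

text \<open>Passing from \<open>\<sigma>\<close> to its inverse transposes the matrix, which negates
  each of an odd number of factors. Hence the sum equals its own negative.\<close>

lemma skew_odd_permanent:
  fixes m :: "'i \<Rightarrow> 'i \<Rightarrow> 'a::field_char_0"
  assumes "odd (card I)" "\<And>i j. m i j = - m j i"
  shows "(\<Sum>\<sigma> | \<sigma> permutes I. \<Prod>j\<in>I. m j (\<sigma> j)) = 0" (is "?S = 0")
proof -
  have "?S = (\<Sum>\<sigma> | \<sigma> permutes I. \<Prod>j\<in>I. m j (inv \<sigma> j))"
    by (rule sum_permutations_inverse)
  also have "\<dots> = (\<Sum>\<sigma> | \<sigma> permutes I. - (\<Prod>j\<in>I. m j (\<sigma> j)))"
  proof (rule sum.cong[OF refl])
    fix \<sigma> assume "\<sigma> \<in> {\<sigma>. \<sigma> permutes I}"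
    then have \<sigma>: "\<sigma> permutes I" by simp
    have "(\<Prod>j\<in>I. m j (inv \<sigma> j)) = (\<Prod>j\<in>I. m (\<sigma> j) (inv \<sigma> (\<sigma> j)))"
      by (rule prod.permute[OF \<sigma>, unfolded o_def])
    also have "\<dots> = (\<Prod>j\<in>I. - m j (\<sigma> j))"
      using permutes_inverses(2)[OF \<sigma>] by (intro prod.cong refl) (simp flip: assms(2))
    also have "\<dots> = - (\<Prod>j\<in>I. m j (\<sigma> j))"
      using assms(1) by (simp add: prod_uminus)
    finally show "(\<Prod>j\<in>I. m j (inv \<sigma> j)) = - (\<Prod>j\<in>I. m j (\<sigma> j))" .
  qed
  also have "\<dots> = - ?S" by (rule sum_negf)
  finally have "?S + ?S = 0" by simp
  then show ?thesis by (simp flip: mult_2)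
qed

section \<open>Linear forms in three variables\<close>

definition lin :: "'a::comm_semiring_1 ^ 3 \<Rightarrow> (3, 'a) mpol" where
  "lin c = (\<Sum>k\<in>UNIV. Poly_Mapping.single (Poly_Mapping.single k 1) (c $ k))"

definition dot :: "'a::comm_semiring_1 ^ 3 \<Rightarrow> 'a ^ 3 \<Rightarrow> 'a" where
  "dot a b = a $ 1 * b $ 1 + a $ 2 * b $ 2 + a $ 3 * b $ 3"

definition cross :: "'a::comm_ring_1 ^ 3 \<Rightarrow> 'a ^ 3 \<Rightarrow> 'a ^ 3" where
  "cross a b = vector [a $ 2 * b $ 3 - a $ 3 * b $ 2, a $ 3 * b $ 1 - a $ 1 * b $ 3, a $ 1 * b $ 2 - a $ 2 * b $ 1]"

lemma cross_nth [simp]: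
  "cross a b $ 1 = a $ 2 * b $ 3 - a $ 3 * b $ 2"
  "cross a b $ 2 = a $ 3 * b $ 1 - a $ 1 * b $ 3"
  "cross a b $ 3 = a $ 1 * b $ 2 - a $ 2 * b $ 1"
  by (simp_all add: cross_def)

lemma vec3_eq_iff: "a = b \<longleftrightarrow> a $ 1 = b $ 1 \<and> a $ 2 = b $ 2 \<and> a $ 3 = b $ (3::3)"
  by (simp add: vec_eq_iff forall_3)

lemma mp_eval_lin: "mp_eval (($) v) (lin c) = dot v c"
  unfolding lin_def mp_eval_sum by (simp add: mp_eval_single sum_3 dot_def mult.commute)

lemma lin_add: "lin (a + b) = lin a + lin b"
  by (simp add: lin_def single_add sum.distrib)

lemma lin_scale: "lin (s *s c) = Poly_Mapping.single 0 s * lin c"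
  by (simp add: lin_def sum_distrib_left mult_single)

lemma mp_smult_eq_mult: "mp_smult c p = Poly_Mapping.single 0 c * p"
proof -
  have "Poly_Mapping.single 0 c * p =
      Poly_Mapping.single 0 c * (\<Sum>m\<in>Poly_Mapping.keys p. Poly_Mapping.single m (Poly_Mapping.lookup p m))"
    by (simp only: sum_single_lookup)
  also have "\<dots> = (\<Sum>m\<in>Poly_Mapping.keys p. mp_smult c (Poly_Mapping.single m (Poly_Mapping.lookup p m)))"
    unfolding sum_distrib_left mult_single
    by (intro sum.cong refl poly_mapping_eqI) (simp add: lookup_mp_smult lookup_single when_def)
  also have "\<dots> = mp_smult c p"
    by (rule poly_mapping_eqI)
      (simp add: lookup_mp_smult lookup_sum lookup_single when_def in_keys_iff if_distrib[of "(*) _"] cong: if_cong)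
  finally show ?thesis by simp
qed

lemma single_0_prod:
  "(\<Prod>i\<in>I. Poly_Mapping.single 0 (s i) :: ('x, 'a::comm_semiring_1) mpol) = Poly_Mapping.single 0 (\<Prod>i\<in>I. s i)"
  by (induction I rule: infinite_finite_induct) (simp_all add: mult_single)

lemma linear_form_lin: "linear_form (lin c)"
proof -
  have "Poly_Mapping.keys (lin c) \<subseteq> (\<Union>k. {Poly_Mapping.single k 1})"
    unfolding lin_def by (rule order_trans[OF keys_sum]) (auto split: if_splits)
  then show ?thesis
    by (fastforce simp: linear_form_def mp_homogeneous_def)
qed

text \<open>The entries of \<open>c\<close> are read off at the three variables; exponents with sum
  1 leave no other monomial.\<close>

lemma linear_form_imp_lin:
  assumes "linear_form l"
  shows "\<exists>c. l = lin c"
proof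
  show "l = lin (\<chi> k. Poly_Mapping.lookup l (Poly_Mapping.single k 1))"
  proof (rule poly_mapping_eqI)
    fix m
    show "Poly_Mapping.lookup l m =
      Poly_Mapping.lookup (lin (\<chi> k. Poly_Mapping.lookup l (Poly_Mapping.single k 1))) m"
    proof (cases "m \<in> range (\<lambda>k. Poly_Mapping.single k 1)")
      case True
      then obtain k0 where m: "m = Poly_Mapping.single k0 1" by blast
      have "Poly_Mapping.single k (1::nat) = Poly_Mapping.single k0 1 \<longleftrightarrow> k = k0" for k :: 3
        by (metis keys_single one_neq_zero singleton_inject)
      then show ?thesis by (simp add: lin_def lookup_sum lookup_single when_def m cong: if_cong)
    next
      case False
      have "m \<notin> Poly_Mapping.keys l"
      proof
        assume "m \<in> Poly_Mapping.keys l"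
        with assms have s: "(\<Sum>x\<in>UNIV. Poly_Mapping.lookup m x) = 1"
          by (simp add: linear_form_def mp_homogeneous_alt)
        then obtain k where k: "Poly_Mapping.lookup m k \<noteq> 0"
          by (metis sum.neutral zero_neq_one)
        have "Poly_Mapping.lookup m k + (\<Sum>x\<in>UNIV - {k}. Poly_Mapping.lookup m x) = 1"
          using s sum.remove[of UNIV k "Poly_Mapping.lookup m"] by simp
        then have "Poly_Mapping.lookup m k = 1" "\<forall>x\<in>UNIV - {k}. Poly_Mapping.lookup m x = 0"
          using k by (auto simp: add_is_1)
        then have "m = Poly_Mapping.single k 1"
          by (intro poly_mapping_eqI) (auto simp: lookup_single when_def)
        with False show False by blast
      qed
      moreover have "Poly_Mapping.single k 1 \<noteq> m" for k using False by blast
      ultimately show ?thesis by (simp add: lin_def lookup_sum lookup_single when_def in_keys_iff)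
    qed
  qed
qed

section \<open>Parallel and orthogonal vectors in three coordinates\<close>

lemma cross_eq_0_imp_scale:
  fixes a q :: "'a::field ^ 3"
  assumes "cross a q = 0" "q \<noteq> 0"
  shows "\<exists>t. a = t *s q"
proof -
  have eq: "a $ 2 * q $ 3 = a $ 3 * q $ 2" "a $ 3 * q $ 1 = a $ 1 * q $ 3" "a $ 1 * q $ 2 = a $ 2 * q $ 1"
    using assms(1) by (simp_all add: vec3_eq_iff)
  consider "q $ 1 \<noteq> 0" | "q $ 2 \<noteq> 0" | "q $ 3 \<noteq> 0" using assms(2) by (auto simp: vec3_eq_iff)
  then show ?thesis
  proof cases
    case 1
    then show ?thesis using eq by (intro exI[of _ "a $ 1 / q $ 1"]) (simp add: vec3_eq_iff field_simps)
  next
    case 2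
    then show ?thesis using eq by (intro exI[of _ "a $ 2 / q $ 2"]) (simp add: vec3_eq_iff field_simps)
  next
    case 3
    then show ?thesis using eq by (intro exI[of _ "a $ 3 / q $ 3"]) (simp add: vec3_eq_iff field_simps)
  qed
qed

text \<open>The expansion of the double cross product of \<open>c\<close> with
  \<open>cross a b\<close> shows that these two vectors are parallel.\<close>

lemma orthogonal_imp_scale_cross:
  fixes a b c :: "'a::field ^ 3"
  assumes "dot a c = 0" "dot b c = 0" "cross a b \<noteq> 0"
  shows "\<exists>s. c = s *s cross a b"
proof -
  have "cross c (cross a b) = dot b c *s a - dot a c *s b"
    by (simp add: vec3_eq_iff dot_def algebra_simps)
  then show ?thesis using assms by (intro cross_eq_0_imp_scale) auto
qed

text \<open>Each case solves \<open>c = cross a u\<close> with the entry of \<open>u\<close> set to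
  zero where \<open>a\<close> has a nonzero entry. The vector \<open>u\<close> later serves as the
  direction in which a vertex moves away from a point.\<close>

lemma orthogonal_imp_cross:
  fixes a c :: "'a::field ^ 3"
  assumes "dot a c = 0" "a \<noteq> 0"
  shows "\<exists>u. c = cross a u"
proof -
  have eq: "a $ 1 * c $ 1 + a $ 2 * c $ 2 + a $ 3 * c $ 3 = 0" using assms(1) by (simp add: dot_def)
  consider "a $ 1 \<noteq> 0" | "a $ 2 \<noteq> 0" | "a $ 3 \<noteq> 0" using assms(2) by (auto simp: vec3_eq_iff)
  then show ?thesis
  proof cases
    case 1
    have "a $ 1 * c $ 1 = - (a $ 2 * c $ 2 + a $ 3 * c $ 3)"
      unfolding eq_neg_iff_add_eq_0 using eq by (simp add: ac_simps)
    with 1 have "c $ 1 = - (a $ 2 * c $ 2 + a $ 3 * c $ 3) / a $ 1"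
      by (metis nonzero_mult_div_cancel_left)
    then show ?thesis using 1
      by (intro exI[of _ "vector [0, c $ 3 / a $ 1, - c $ 2 / a $ 1]"])
        (simp add: vec3_eq_iff add_divide_distrib diff_divide_distrib)
  next
    case 2
    have "a $ 2 * c $ 2 = - (a $ 1 * c $ 1 + a $ 3 * c $ 3)"
      unfolding eq_neg_iff_add_eq_0 using eq by (simp add: ac_simps)
    with 2 have "c $ 2 = - (a $ 1 * c $ 1 + a $ 3 * c $ 3) / a $ 2"
      by (metis nonzero_mult_div_cancel_left)
    then show ?thesis using 2
      by (intro exI[of _ "vector [- c $ 3 / a $ 2, 0, c $ 1 / a $ 2]"])
        (simp add: vec3_eq_iff add_divide_distrib diff_divide_distrib)
  next
    case 3
    have "a $ 3 * c $ 3 = - (a $ 1 * c $ 1 + a $ 2 * c $ 2)"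
      unfolding eq_neg_iff_add_eq_0 using eq by (simp add: ac_simps)
    with 3 have "c $ 3 = - (a $ 1 * c $ 1 + a $ 2 * c $ 2) / a $ 3"
      by (metis nonzero_mult_div_cancel_left)
    then show ?thesis using 3
      by (intro exI[of _ "vector [c $ 2 / a $ 3, - c $ 1 / a $ 3, 0]"])
        (simp add: vec3_eq_iff add_divide_distrib diff_divide_distrib)
  qed
qed

lemma proj_plane_obtain:
  fixes L :: "('a::field ^ 3) set"
  assumes "L \<in> proj_plane"
  obtains q where "q \<in> L" "q \<noteq> 0"
proof -
  have "\<not> L \<subseteq> {0}"
  proof
    assume "L \<subseteq> {0}"
    then have "vec.dim L \<le> card ({} :: ('a ^ 3) set)"
      by (intro vec.dim_le_card) auto
    then have "vec.dim L \<le> 0" unfolding card.empty .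
    moreover have "vec.dim L = 1" using assms by (simp add: proj_plane_def)
    ultimately show False by linarith
  qed
  then show ?thesis using that by blast
qed

lemma span_in_proj_plane:
  fixes q :: "'a::field ^ 3"
  assumes "q \<noteq> 0"
  shows "vec.span {q} \<in> proj_plane"
  using assms vec.dim_span_eq_card_independent[of "{q}"]
  by (simp add: proj_plane_def vec.subspace_span vec.independent_insert)

section \<open>Multihomogeneous polynomials\<close>

text \<open>The multidegree is a parameter because sums need a common multidegree, while products
  add multidegrees.\<close>

definition multihomogeneous_deg :: "nat \<Rightarrow> (nat \<Rightarrow> nat) \<Rightarrow> (nat \<times> 3, 'a::zero) mpol \<Rightarrow> bool" where
  "multihomogeneous_deg d e f \<longleftrightarrow> (\<forall>m\<in>Poly_Mapping.keys f.
     Poly_Mapping.keys m \<subseteq> {1..d} \<times> UNIV \<and>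
     (\<forall>i\<in>{1..d}. (\<Sum>j\<in>UNIV. Poly_Mapping.lookup m (i, j)) = e i))"

lemma multihomogeneous_degI: "multihomogeneous_deg d e f \<Longrightarrow> multihomogeneous d f"
  by (auto simp: multihomogeneous_deg_def multihomogeneous_def)

lemma multihomogeneous_deg_0: "multihomogeneous_deg d e 0"
  by (simp add: multihomogeneous_deg_def)

lemma multihomogeneous_deg_cong:
  "multihomogeneous_deg d e f \<Longrightarrow> (\<And>i. i \<in> {1..d} \<Longrightarrow> e i = e' i) \<Longrightarrow> multihomogeneous_deg d e' f"
  by (simp add: multihomogeneous_deg_def)

lemma multihomogeneous_deg_const: "multihomogeneous_deg d (\<lambda>_. 0) (Poly_Mapping.single 0 c)"
  by (simp add: multihomogeneous_deg_def)

lemma multihomogeneous_deg_add: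
  assumes "multihomogeneous_deg d e f" "multihomogeneous_deg d e g"
  shows "multihomogeneous_deg d e (f + g)"
  using assms keys_add[of f g] unfolding multihomogeneous_deg_def by blast

lemma multihomogeneous_deg_diff:
  fixes f g :: "(nat \<times> 3, 'a::comm_ring_1) mpol"
  assumes "multihomogeneous_deg d e f" "multihomogeneous_deg d e g"
  shows "multihomogeneous_deg d e (f - g)"
proof -
  have "Poly_Mapping.keys (f - g) \<subseteq> Poly_Mapping.keys f \<union> Poly_Mapping.keys g"
    by (auto simp: in_keys_iff lookup_minus)
  with assms show ?thesis unfolding multihomogeneous_deg_def by blast
qed

lemma multihomogeneous_deg_sum:
  assumes "\<And>a. a \<in> A \<Longrightarrow> multihomogeneous_deg d e (f a)"
  shows "multihomogeneous_deg d e (\<Sum>a\<in>A. f a)"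
  using assms
  by (induction A rule: infinite_finite_induct)
    (simp_all add: multihomogeneous_deg_0 multihomogeneous_deg_add)

lemma multihomogeneous_deg_mult:
  fixes f g :: "(nat \<times> 3, 'a::comm_semiring_1) mpol"
  assumes "multihomogeneous_deg d e f" "multihomogeneous_deg d e' g"
  shows "multihomogeneous_deg d (\<lambda>i. e i + e' i) (f * g)"
  unfolding multihomogeneous_deg_def
proof
  fix m assume "m \<in> Poly_Mapping.keys (f * g)"
  with keys_mult[of f g] obtain a b where
    ab: "a \<in> Poly_Mapping.keys f" "b \<in> Poly_Mapping.keys g" "m = a + b" by blast
  have "Poly_Mapping.keys m \<subseteq> Poly_Mapping.keys a \<union> Poly_Mapping.keys b"
    unfolding ab(3) by (rule keys_add)
  with ab assms show "Poly_Mapping.keys m \<subseteq> {1..d} \<times> UNIV \<and>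
     (\<forall>i\<in>{1..d}. (\<Sum>j\<in>UNIV. Poly_Mapping.lookup m (i, j)) = e i + e' i)"
    unfolding multihomogeneous_deg_def by (simp add: lookup_add sum.distrib) blast
qed

lemma multihomogeneous_deg_prod:
  fixes f :: "'i \<Rightarrow> (nat \<times> 3, 'a::comm_semiring_1) mpol"
  assumes "\<And>a. a \<in> A \<Longrightarrow> multihomogeneous_deg d (e a) (f a)"
  shows "multihomogeneous_deg d (\<lambda>i. \<Sum>a\<in>A. e a i) (\<Prod>a\<in>A. f a)"
  using assms
proof (induction A rule: infinite_finite_induct)
  case (insert a A)
  then show ?case by (simp add: multihomogeneous_deg_mult)
qed (use multihomogeneous_deg_const[of d "1 :: 'a"] in simp_all)

definition coord :: "nat \<Rightarrow> 3 \<Rightarrow> (nat \<times> 3, 'a::comm_semiring_1) mpol" where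
  "coord i k = Poly_Mapping.single (Poly_Mapping.single (i, k) 1) 1"

lemma mp_eval_coord: "mp_eval v (coord i k) = v (i, k)"
  by (simp add: coord_def mp_eval_single)

lemma multihomogeneous_deg_coord:
  assumes "i \<in> {1..d}"
  shows "multihomogeneous_deg d (\<lambda>j. of_bool (j = i)) (coord i k)"
  using assms by (auto simp: multihomogeneous_deg_def coord_def lookup_single when_def of_bool_def)

text \<open>The 3x3 determinant, over any commutative ring so that it applies to coordinates as well
  as to the polynomials \<open>coord i\<close>.\<close>

definition bracket :: "(3 \<Rightarrow> 'a::comm_ring_1) \<Rightarrow> (3 \<Rightarrow> 'a) \<Rightarrow> (3 \<Rightarrow> 'a) \<Rightarrow> 'a" where
  "bracket a b c = a 1 * (b 2 * c 3 - b 3 * c 2) + a 2 * (b 3 * c 1 - b 1 * c 3) + a 3 * (b 1 * c 2 - b 2 * c 1)"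

lemma mp_eval_bracket:
  "mp_eval v (bracket a b c) = bracket (\<lambda>k. mp_eval v (a k)) (\<lambda>k. mp_eval v (b k)) (\<lambda>k. mp_eval v (c k))"
  for v :: "'x \<Rightarrow> 'a::comm_ring_1"
  by (simp add: bracket_def mp_eval_add mp_eval_mult mp_eval_diff)

lemma multihomogeneous_deg_bracket:
  fixes a b c :: "3 \<Rightarrow> (nat \<times> 3, 'a::comm_ring_1) mpol"
  assumes "\<And>k. multihomogeneous_deg d e (a k)" "\<And>k. multihomogeneous_deg d e' (b k)"
    "\<And>k. multihomogeneous_deg d e'' (c k)"
  shows "multihomogeneous_deg d (\<lambda>i. e i + (e' i + e'' i)) (bracket a b c)"
  unfolding bracket_def
  by (intro multihomogeneous_deg_add multihomogeneous_deg_mult multihomogeneous_deg_diff assms)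

text \<open>The nonvanishing locus of one multihomogeneous polynomial is open, and \<open>P0\<close>
  shows that it is nonempty.\<close>

lemma holds_genericallyI:
  fixes f :: "(nat \<times> 3, 'a::field) mpol"
  assumes f: "multihomogeneous d f"
    and P0: "P0 \<in> plane_tuples d" "\<not> vanishes_at_tuple d f P0"
    and \<Phi>: "\<And>P. P \<in> plane_tuples d \<Longrightarrow> \<not> vanishes_at_tuple d f P \<Longrightarrow> \<Phi> P"
  shows "holds_generically d \<Phi>"
  unfolding holds_generically_def
proof (intro exI conjI)
  let ?U = "{P \<in> plane_tuples d. \<not> vanishes_at_tuple d f P}"
  have "plane_tuples d - ?U = {P \<in> plane_tuples d. \<forall>g\<in>{f}. vanishes_at_tuple d g P}" by auto
  then show "zariski_open d ?U"
    unfolding zariski_open_def zariski_closed_def using f by blast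
  show "?U \<noteq> {}" using P0 by blast
  show "\<forall>P\<in>?U. \<Phi> P" using \<Phi> by blast
qed

section \<open>The span of the cone polynomials\<close>

lemma dot_cross: "dot a (cross b c) = bracket (($) a) (($) b) (($) c)"
  by (simp add: dot_def bracket_def)

lemma dot_sum_left: "dot (\<Sum>i\<in>A. v i) c = (\<Sum>i\<in>A. dot (v i) c)"
  by (simp add: dot_def sum.distrib sum_distrib_right)

text \<open>Single evaluations, the polarization and the functional of the parity argument all have
  this form.\<close>

lemma subspace_eval_combination:
  fixes x :: "'i \<Rightarrow> 'x \<Rightarrow> 'a::field"
  shows "mp.subspace {p. (\<Sum>a\<in>A. k a * mp_eval (x a) p) = 0}"
proof (rule mp.subspaceI; clarify)
  fix p q :: "('x, 'a) mpol" and c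
  assume pq: "(\<Sum>a\<in>A. k a * mp_eval (x a) p) = 0" "(\<Sum>a\<in>A. k a * mp_eval (x a) q) = 0"
  show "(\<Sum>a\<in>A. k a * mp_eval (x a) (p + q)) = 0"
    using pq by (simp add: mp_eval_add distrib_left sum.distrib)
  have "(\<Sum>a\<in>A. k a * mp_eval (x a) (mp_smult c p)) = c * (\<Sum>a\<in>A. k a * mp_eval (x a) p)"
    by (simp add: mp_eval_smult sum_distrib_left ac_simps)
  then show "(\<Sum>a\<in>A. k a * mp_eval (x a) (mp_smult c p)) = 0" using pq by simp
qed simp

lemma subspace_eval: "mp.subspace {p. mp_eval x p = (0 :: 'a::field)}"
  using subspace_eval_combination[of "\<lambda>_. 1" "\<lambda>_. x" "{()}"] by simp

section \<open>Cone forms and the functionals that annihilate them\<close>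

definition cone_at :: "nat \<Rightarrow> (nat \<Rightarrow> 'a::field ^ 3) \<Rightarrow> 'a ^ 3 \<Rightarrow> (3, 'a) mpol" where
  "cone_at d v q = (\<Prod>i\<in>{1..d}. lin (cross (v i) q))"

text \<open>On a form of degree \<open>d\<close> this is \<open>d!\<close> times the associated
  symmetric multilinear form at \<open>v 1, ..., v d\<close>. As a combination of evaluations it is
  visibly linear and has the shape of \<open>ryser\<close>.\<close>

definition polarization :: "nat \<Rightarrow> (nat \<Rightarrow> 'a::field ^ 3) \<Rightarrow> (3, 'a) mpol \<Rightarrow> 'a" where
  "polarization d v p = (\<Sum>A\<in>Pow {1..d}. (-1) ^ card ({1..d} - A) * mp_eval (($) (\<Sum>i\<in>A. v i)) p)"

lemma subspace_polarization: "mp.subspace {p. polarization d v p = 0}"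
  unfolding polarization_def by (rule subspace_eval_combination)

lemma mp_eval_prod_lin: "mp_eval (($) x) (\<Prod>i\<in>I. lin (c i)) = (\<Prod>i\<in>I. dot x (c i))"
  by (simp add: mp_eval_prod mp_eval_lin)

lemma homogeneous_prod_lin:
  fixes c :: "nat \<Rightarrow> 'a::field ^ 3"
  shows "mp_homogeneous d (\<Prod>i\<in>{1..d}. lin (c i))"
proof -
  have "mp_homogeneous (card {1..d}) (\<Prod>i\<in>{1..d}. lin (c i))"
    by (intro mp_homogeneous_prod linear_form_lin[unfolded linear_form_def]) simp
  then show ?thesis by simp
qed

lemma polarization_prod_lin:
  "polarization d v (\<Prod>j\<in>{1..d}. lin (c j)) = (\<Sum>\<sigma> | \<sigma> permutes {1..d}. \<Prod>j\<in>{1..d}. dot (v (\<sigma> j)) (c j))"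
  unfolding polarization_def mp_eval_prod_lin dot_sum_left by (rule ryser) simp

lemma polarization_cone_at:
  fixes v :: "nat \<Rightarrow> 'a::field_char_0 ^ 3"
  assumes "odd d"
  shows "polarization d v (cone_at d v q) = 0"
  unfolding cone_at_def polarization_prod_lin
  by (rule skew_odd_permanent) (use assms in \<open>simp_all add: dot_def algebra_simps\<close>)

lemma mp_eval_cone_at_point:
  assumes "i \<in> {1..d}"
  shows "mp_eval (($) (v i)) (cone_at d v q) = 0"
  unfolding cone_at_def mp_eval_prod_lin
  by (rule prod_zero) (use assms in \<open>auto simp: dot_def algebra_simps intro!: bexI[of _ i]\<close>)

text \<open>Exchanging \<open>x\<close> and \<open>q\<close> negates each of an odd number of
  determinants.\<close>

lemma mp_eval_cone_at_swap:
  assumes "odd d"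
  shows "mp_eval (($) x) (cone_at d v q) = - mp_eval (($) q) (cone_at d v x)"
proof -
  have "(\<Prod>i\<in>{1..d}. dot x (cross (v i) q)) = (\<Prod>i\<in>{1..d}. - dot q (cross (v i) x))"
    by (rule prod.cong) (simp_all add: dot_def algebra_simps)
  also have "\<dots> = - (\<Prod>i\<in>{1..d}. dot q (cross (v i) x))"
    using assms by (simp add: prod_uminus)
  finally show ?thesis unfolding cone_at_def mp_eval_prod_lin .
qed

section \<open>Cones whose vertex is one of the points\<close>

text \<open>\<open>p(2\<epsilon>) - 2\<^sup>n p(\<epsilon>)\<close> has degree below \<open>n\<close>, which drives the induction.\<close>

lemma coefficients_in_subspace:
  fixes g :: "nat \<Rightarrow> ('x, 'a::field_char_0) mpol"
  assumes "mp.subspace S" "\<And>\<epsilon>. (\<Sum>k\<le>n. mp_smult (\<epsilon> ^ k) (g k)) \<in> S" "k \<le> n"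
  shows "g k \<in> S"
  using assms(2,3)
proof (induction n arbitrary: g k)
  case 0
  then show ?case using "0.prems"(1)[of 1] by simp
next
  case (Suc n)
  let ?p = "\<lambda>\<epsilon>. \<Sum>k\<le>Suc n. mp_smult (\<epsilon> ^ k) (g k)"
  have low: "g k \<in> S" if "k \<le> n" for k
  proof -
    \<comment> \<open>The factor \<open>2 ^ k - 2 ^ Suc n\<close> is zero for the top term, which
      therefore disappears, and nonzero for the terms that remain.\<close>
    have "(\<Sum>k\<le>n. mp_smult (\<epsilon> ^ k) (mp_smult (2 ^ k - 2 ^ Suc n) (g k))) =
        ?p (2 * \<epsilon>) - mp_smult (2 ^ Suc n) (?p \<epsilon>)" for \<epsilon>
      by (simp add: mp.scale_sum_right mp.scale_right_distrib mp.scale_left_diff_distrib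
          power_mult_distrib algebra_simps sum_subtractf)
    moreover have "?p (2 * \<epsilon>) - mp_smult (2 ^ Suc n) (?p \<epsilon>) \<in> S" for \<epsilon>
      using Suc.prems(1) assms(1) mp.subspace_diff mp.subspace_scale by blast
    ultimately have "mp_smult (2 ^ k - 2 ^ Suc n) (g k) \<in> S"
      using that Suc.IH[of "\<lambda>k. mp_smult (2 ^ k - 2 ^ Suc n) (g k)"] by simp
    then have "mp_smult (inverse (2 ^ k - 2 ^ Suc n)) (mp_smult (2 ^ k - 2 ^ Suc n) (g k)) \<in> S"
      by (rule mp.subspace_scale[OF assms(1)])
    moreover have "(2 :: 'a) ^ k \<noteq> 2 ^ Suc n"
    proof
      assume "(2 :: 'a) ^ k = 2 ^ Suc n"
      then have "of_nat (2 ^ k) = (of_nat (2 ^ Suc n) :: 'a)" by simp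
      then have "(2 :: nat) ^ k = 2 ^ Suc n" unfolding of_nat_eq_iff .
      then show False using that by (simp only: power_inject_exp)
    qed
    ultimately show ?thesis by simp
  qed
  have "(\<Sum>k\<le>n. g k) \<in> S" using low by (intro mp.subspace_sum assms(1)) simp
  moreover have "(\<Sum>k\<le>n. g k) + g (Suc n) \<in> S" using Suc.prems(1)[of 1] by simp
  ultimately have "((\<Sum>k\<le>n. g k) + g (Suc n)) - (\<Sum>k\<le>n. g k) \<in> S"
    using assms(1) mp.subspace_diff by blast
  then have "g (Suc n) \<in> S" by simp
  then show ?case using low Suc.prems(2) le_Suc_eq by blast
qed

text \<open>When the product is expanded, the coefficient of \<open>\<epsilon> ^ k\<close> collects
  the terms with exactly \<open>k\<close> factors taken from \<open>b\<close>.\<close>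

lemma prod_linear_curve:
  fixes a b :: "'i \<Rightarrow> ('x, 'a::field) mpol"
  assumes "finite I"
  shows "\<exists>g n. g 0 = (\<Prod>i\<in>I. a i) \<and>
    (\<forall>\<epsilon>. (\<Prod>i\<in>I. a i + mp_smult \<epsilon> (b i)) = (\<Sum>k\<le>n. mp_smult (\<epsilon> ^ k) (g k)))"
proof (intro exI conjI allI)
  define h where "h X = (\<Prod>i\<in>X. b i) * (\<Prod>i\<in>I - X. a i)" for X
  let ?g = "\<lambda>k. \<Sum>X | X \<in> Pow I \<and> card X = k. h X"
  have "{X. X \<in> Pow I \<and> card X = 0} = {{}}"
    using assms by (auto dest: finite_subset)
  then show "?g 0 = (\<Prod>i\<in>I. a i)" by (simp add: h_def)
  fix \<epsilon>
  have smult_prod: "(\<Prod>i\<in>X. mp_smult \<epsilon> (b i)) * c = mp_smult (\<epsilon> ^ card X) ((\<Prod>i\<in>X. b i) * c)" for X c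
    by (simp add: mp_smult_eq_mult prod.distrib single_0_prod ac_simps flip: prod_constant)
  have "(\<Prod>i\<in>I. a i + mp_smult \<epsilon> (b i)) = (\<Prod>i\<in>I. mp_smult \<epsilon> (b i) + a i)"
    by (simp add: add.commute)
  also have "\<dots> = (\<Sum>X\<in>Pow I. mp_smult (\<epsilon> ^ card X) (h X))"
    unfolding h_def prod_add[OF assms] smult_prod ..
  also have "\<dots> = (\<Sum>k\<in>{..card I}. \<Sum>X | X \<in> Pow I \<and> card X = k. mp_smult (\<epsilon> ^ card X) (h X))"
    by (rule sum.group[symmetric]) (use assms card_mono in auto)
  also have "\<dots> = (\<Sum>k\<le>card I. mp_smult (\<epsilon> ^ k) (?g k))"
    by (simp add: mp.scale_sum_right)
  finally show "(\<Prod>i\<in>I. a i + mp_smult \<epsilon> (b i)) = (\<Sum>k\<le>card I. mp_smult (\<epsilon> ^ k) (?g k))" .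
qed

lemma mp_smult_mult:
  fixes p q :: "('x, 'a::comm_semiring_1) mpol"
  shows "mp_smult a p * mp_smult b q = mp_smult (a * b) (p * q)"
proof -
  have "(Poly_Mapping.single 0 (a * b) :: ('x, 'a) mpol) = Poly_Mapping.single 0 a * Poly_Mapping.single 0 b"
    by (simp add: mult_single)
  then show ?thesis by (simp only: mp_smult_eq_mult ac_simps)
qed

lemma cross_add_scale: "cross a (q + \<epsilon> *s u) = cross a q + \<epsilon> *s cross a u"
  by (simp add: vec3_eq_iff algebra_simps)

text \<open>If the vertex is none of the points, each line is determined up to scaling and
  \<open>p\<close> is a multiple of a cone form. If it is the point of \<open>v i\<close>, only
  \<open>L i\<close> is free; for a suitable \<open>u\<close>, \<open>p\<close> is then a multiple
  of the coefficient of \<open>\<epsilon>\<close> in the cone form with vertex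
  \<open>q + \<epsilon> *s u\<close>, and such coefficients stay in the span.\<close>

lemma cone_polynomials_subset_span:
  fixes v :: "nat \<Rightarrow> 'a::field_char_0 ^ 3"
  assumes v: "\<And>i. i \<in> {1..d} \<Longrightarrow> v i \<in> P i \<and> v i \<noteq> 0"
    and indep: "\<And>i j. i \<in> {1..d} \<Longrightarrow> j \<in> {1..d} \<Longrightarrow> i \<noteq> j \<Longrightarrow> cross (v i) (v j) \<noteq> 0"
  shows "cone_polynomials d P \<subseteq> mp.span (range (cone_at d v))"
proof
  let ?S = "mp.span (range (cone_at d v))"
  fix p assume "p \<in> cone_polynomials d P"
  then obtain Q L where p: "p = (\<Prod>i\<in>{1..d}. L i)" and Q: "Q \<in> proj_plane"
    and L: "\<And>i. i \<in> {1..d} \<Longrightarrow> linear_form (L i) \<and> vanishes_at (L i) (P i) \<and> vanishes_at (L i) Q"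
    unfolding cone_polynomials_def by blast
  obtain q where q: "q \<in> Q" "q \<noteq> 0" using proj_plane_obtain[OF Q] .
  have "\<exists>c. L i = lin c \<and> dot (v i) c = 0 \<and> dot q c = 0" if "i \<in> {1..d}" for i
    using linear_form_imp_lin[of "L i"] L[OF that] v[OF that] q
    by (auto simp: vanishes_at_def mp_eval_lin)
  then obtain c where c: "\<And>i. i \<in> {1..d} \<Longrightarrow> L i = lin (c i) \<and> dot (v i) (c i) = 0 \<and> dot q (c i) = 0"
    by metis
  have "\<exists>s. L i = Poly_Mapping.single 0 s * lin (cross (v i) q)" if "i \<in> {1..d}" "cross (v i) q \<noteq> 0" for i
    using orthogonal_imp_scale_cross[OF _ _ that(2), of "c i"] c[OF that(1)] by (auto simp: lin_scale)
  then obtain s where s: "\<And>i. i \<in> {1..d} \<Longrightarrow> cross (v i) q \<noteq> 0 \<Longrightarrow>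
      L i = Poly_Mapping.single 0 (s i) * lin (cross (v i) q)"
    by metis
  show "p \<in> ?S"
  proof (cases "\<exists>i\<in>{1..d}. cross (v i) q = 0")
    case False
    then have "p = (\<Prod>i\<in>{1..d}. Poly_Mapping.single 0 (s i) * lin (cross (v i) q))"
      unfolding p using s by (intro prod.cong) auto
    also have "\<dots> = mp_smult (\<Prod>i\<in>{1..d}. s i) (cone_at d v q)"
      by (simp add: prod.distrib single_0_prod mp_smult_eq_mult cone_at_def)
    finally show ?thesis by (simp add: mp.span_base mp.span_scale)
  next
    case True
    then obtain i where i: "i \<in> {1..d}" "cross (v i) q = 0" by blast
    obtain t where t: "v i = t *s q" using cross_eq_0_imp_scale[OF i(2) q(2)] by blast
    let ?J = "{1..d} - {i}"
    \<comment> \<open>The points are distinct, so the vertex coincides with at most one of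
      them.\<close>
    have nz: "cross (v j) q \<noteq> 0" if "j \<in> ?J" for j
    proof
      assume "cross (v j) q = 0"
      then have "cross (v j) (v i) = 0"
        using cross_add_scale[of "v j" 0 t q] by (simp add: t vec3_eq_iff)
      then show False using indep[of j i] that i(1) by auto
    qed
    obtain u where u: "c i = cross (v i) u"
      using orthogonal_imp_cross[of "v i" "c i"] c i(1) v by blast
    let ?a = "\<lambda>j. lin (cross (v j) q)" and ?b = "\<lambda>j. lin (cross (v j) u)"
    obtain g n where g: "g 0 = (\<Prod>j\<in>?J. ?a j)"
      "\<And>\<epsilon>. (\<Prod>j\<in>?J. ?a j + mp_smult \<epsilon> (?b j)) = (\<Sum>k\<le>n. mp_smult (\<epsilon> ^ k) (g k))"
      using prod_linear_curve[of ?J ?a ?b] by auto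
    \<comment> \<open>The factor with index \<open>i\<close> is \<open>\<epsilon>\<close> times
      \<open>?b i\<close>, which shifts the coefficients by one and leaves no constant term.\<close>
    define h where "h k = (case k of 0 \<Rightarrow> 0 | Suc k \<Rightarrow> ?b i * g k)" for k
    have "(\<Sum>k\<le>Suc n. mp_smult (\<epsilon> ^ k) (h k)) = cone_at d v (q + \<epsilon> *s u)" for \<epsilon>
    proof -
      have "cone_at d v (q + \<epsilon> *s u) = (\<Prod>j\<in>{1..d}. ?a j + mp_smult \<epsilon> (?b j))"
        by (simp add: cone_at_def cross_add_scale lin_add lin_scale mp_smult_eq_mult)
      also have "\<dots> = (?a i + mp_smult \<epsilon> (?b i)) * (\<Prod>j\<in>?J. ?a j + mp_smult \<epsilon> (?b j))"
        using i(1) by (simp add: prod.remove)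
      also have "?a i = 0" by (simp add: i(2) lin_def)
      also have "(0 + mp_smult \<epsilon> (?b i)) * (\<Prod>j\<in>?J. ?a j + mp_smult \<epsilon> (?b j)) =
          (\<Sum>k\<le>n. mp_smult (\<epsilon> ^ Suc k) (?b i * g k))"
        unfolding g(2)
        by (simp add: sum_distrib_left mp_smult_mult)
      also have "\<dots> = (\<Sum>k\<le>Suc n. mp_smult (\<epsilon> ^ k) (h k))"
        unfolding sum.atMost_Suc_shift by (simp add: h_def)
      finally show ?thesis by simp
    qed
    then have "(\<Sum>k\<le>Suc n. mp_smult (\<epsilon> ^ k) (h k)) \<in> ?S" for \<epsilon>
      by (metis mp.span_base rangeI)
    then have "h 1 \<in> ?S"
      by (rule coefficients_in_subspace[OF mp.subspace_span, where n = "Suc n" and k = 1]) simp_all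
    then have base: "?b i * (\<Prod>j\<in>?J. ?a j) \<in> ?S" by (simp add: h_def g(1))
    have "p = L i * (\<Prod>j\<in>?J. L j)" unfolding p using i(1) by (simp add: prod.remove)
    also have "(\<Prod>j\<in>?J. L j) = (\<Prod>j\<in>?J. Poly_Mapping.single 0 (s j) * ?a j)"
      using s nz by (intro prod.cong) auto
    also have "L i = ?b i" using c[OF i(1)] u by simp
    also have "?b i * (\<Prod>j\<in>?J. Poly_Mapping.single 0 (s j) * ?a j) =
        mp_smult (\<Prod>j\<in>?J. s j) (?b i * (\<Prod>j\<in>?J. ?a j))"
      by (simp add: prod.distrib single_0_prod mp_smult_eq_mult ac_simps)
    finally show ?thesis using base by (simp add: mp.span_scale)
  qed
qed

section \<open>Parity of the dimension\<close>

text \<open>The values of the basis forms at each other's vertices form a skew-symmetric matrix. For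
  odd size, a kernel vector \<open>c\<close> yields a nontrivial combination \<open>p\<close> of the
  basis that vanishes everywhere, contradicting independence.\<close>

lemma even_card_cone_basis:
  fixes v :: "nat \<Rightarrow> 'a::field_char_0 ^ 3"
  assumes "odd d" and B: "finite B" "mp.independent B" "B \<subseteq> range (cone_at d v)"
    "range (cone_at d v) \<subseteq> mp.span B"
  shows "even (card B)"
proof (rule ccontr)
  assume odd: "odd (card B)"
  define q where "q = inv (cone_at d v)"
  have q: "cone_at d v (q b) = b" if "b \<in> B" for b
    unfolding q_def using B(3) that by (intro f_inv_into_f) blast
  define M where "M a b = mp_eval (($) (q a)) b" for a b
  have skew: "M a b = - M b a" if "a \<in> B" "b \<in> B" for a b
    using mp_eval_cone_at_swap[OF assms(1), of "q a" v "q b"] q that by (simp add: M_def)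
  obtain c where c: "\<exists>a\<in>B. c a \<noteq> 0" "\<And>a. a \<in> B \<Longrightarrow> (\<Sum>b\<in>B. M a b * c b) = 0"
    using skew_odd_kernel[OF B(1) odd, of M] skew by blast
  define p where "p = (\<Sum>b\<in>B. mp_smult (c b) b)"
  \<comment> \<open>The kernel equation says that evaluation at the vertices, weighted by
    \<open>c\<close>, annihilates the basis, hence every cone form.\<close>
  let ?K = "{g. (\<Sum>b\<in>B. c b * mp_eval (($) (q b)) g) = 0}"
  have "B \<subseteq> ?K"
  proof
    fix a assume a: "a \<in> B"
    have "(\<Sum>b\<in>B. c b * mp_eval (($) (q b)) a) = (\<Sum>b\<in>B. - (M a b * c b))"
    proof (rule sum.cong[OF refl])
      fix b assume "b \<in> B"
      have "c b * mp_eval (($) (q b)) a = c b * M b a" by (simp add: M_def)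
      also have "\<dots> = - (M a b * c b)" unfolding skew[OF \<open>b \<in> B\<close> a] by simp
      finally show "c b * mp_eval (($) (q b)) a = - (M a b * c b)" .
    qed
    then show "a \<in> ?K" using c(2)[OF a] by (simp add: sum_negf)
  qed
  then have K: "mp.span B \<subseteq> ?K" by (rule mp.span_minimal) (rule subspace_eval_combination)
  have "mp_eval (($) x) p = 0" for x
  proof -
    \<comment> \<open>By the swap symmetry, \<open>p\<close> at \<open>x\<close> is minus that
      functional applied to the cone form with vertex \<open>x\<close>.\<close>
    have "mp_eval (($) x) p = (\<Sum>b\<in>B. - (c b * mp_eval (($) (q b)) (cone_at d v x)))"
      unfolding p_def mp_eval_sum mp_eval_smult
    proof (rule sum.cong[OF refl])
      fix b assume "b \<in> B"
      then show "c b * mp_eval (($) x) b = - (c b * mp_eval (($) (q b)) (cone_at d v x))"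
        using mp_eval_cone_at_swap[OF assms(1), of x v "q b"] q by simp
    qed
    also have "\<dots> = 0" using K B(4) by (auto simp: sum_negf)
    finally show ?thesis .
  qed
  then have "p = 0" by (rule mp_eval_eq_0_imp)
  then show False using c(1) B(1,2) unfolding p_def mp.dependent_finite[OF B(1)] by blast
qed

section \<open>Independence of the functionals and the dimension bound\<close>

text \<open>Since \<open>K i\<close> contains \<open>B\<close> and all other \<open>w j\<close> but
  not \<open>w i\<close>, adjoining the \<open>w i\<close> one at a time preserves
  independence.\<close>

lemma independent_extend_dual:
  fixes w :: "'i \<Rightarrow> ('x, 'a::field) mpol"
  assumes "finite I" "finite B" "mp.independent B"
    "\<And>i. i \<in> I \<Longrightarrow> mp.subspace (K i) \<and> B \<subseteq> K i \<and> w i \<notin> K i"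
    "\<And>i j. i \<in> I \<Longrightarrow> j \<in> I \<Longrightarrow> i \<noteq> j \<Longrightarrow> w j \<in> K i"
  shows "\<exists>B'. finite B' \<and> mp.independent B' \<and> card B' = card B + card I \<and> B' \<subseteq> B \<union> w ` I"
  using assms
proof (induction I rule: finite_induct)
  case empty
  then show ?case by auto
next
  case (insert i I)
  obtain B' where B': "finite B'" "mp.independent B'" "card B' = card B + card I" "B' \<subseteq> B \<union> w ` I"
    using insert.IH insert.prems by auto
  have "B' \<subseteq> K i" using B'(4) insert.prems insert.hyps by blast
  then have "mp.span B' \<subseteq> K i" using insert.prems(3) by (intro mp.span_minimal) auto
  then have "w i \<notin> mp.span B'" using insert.prems(3) by auto
  then have "mp.independent (insert (w i) B')" "w i \<notin> B'"
    using B'(2) mp.independent_insertI mp.span_base by blast+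
  then show ?case using B' insert.hyps by (intro exI[of _ "insert (w i) B'"]) auto
qed

text \<open>A monomial of degree \<open>d\<close> is determined by its first two exponents, which
  range over a triangle of \<open>(d + 2) choose 2\<close> pairs.\<close>

lemma homogeneous_spanning_set:
  "\<exists>B :: (3, 'a::field) mpol set. finite B \<and> card B \<le> (d + 2) choose 2 \<and> {p. mp_homogeneous d p} \<subseteq> mp.span B"
proof (intro exI conjI)
  let ?M = "{m :: 3 \<Rightarrow>\<^sub>0 nat. (\<Sum>x\<in>UNIV. Poly_Mapping.lookup m x) = d}"
  let ?T = "Sigma {..d} (\<lambda>a. {..d - a})"
  let ?f = "\<lambda>m :: 3 \<Rightarrow>\<^sub>0 nat. (Poly_Mapping.lookup m 1, Poly_Mapping.lookup m 2)"
  let ?mon = "\<lambda>m. Poly_Mapping.single m (1 :: 'a)"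
  have inj: "inj_on ?f ?M"
  proof (rule inj_onI)
    fix m n assume mn: "m \<in> ?M" "n \<in> ?M" "?f m = ?f n"
    then have "Poly_Mapping.lookup m 3 = Poly_Mapping.lookup n 3" by (simp add: sum_3)
    then have "Poly_Mapping.lookup m k = Poly_Mapping.lookup n k" for k
      using mn(3) exhaust_3[of k] by auto
    then show "m = n" by (rule poly_mapping_eqI)
  qed
  have im: "?f ` ?M \<subseteq> ?T" by (auto simp: sum_3)
  have fin: "finite ?M" using inj_on_finite[OF inj im] by simp
  then show "finite (?mon ` ?M)" by (rule finite_imageI)
  have "card (?mon ` ?M) \<le> card ?M" by (rule card_image_le[OF fin])
  also have "\<dots> \<le> card ?T" by (rule card_inj_on_le[OF inj im]) simp
  also have "card ?T = (\<Sum>a\<le>d. Suc (d - a))" by simp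
  also have "\<dots> = (\<Sum>a\<le>d. Suc a)"
    by (rule sum.reindex_bij_witness[of _ "\<lambda>a. d - a" "\<lambda>a. d - a"]) auto
  also have "\<dots> = (d + 2) choose 2"
    by (induction d) (simp_all add: numeral_2_eq_2)
  finally show "card (?mon ` ?M) \<le> (d + 2) choose 2" .
  show "{p :: (3, 'a) mpol. mp_homogeneous d p} \<subseteq> mp.span (?mon ` ?M)"
  proof
    fix p :: "(3, 'a) mpol" assume "p \<in> {p. mp_homogeneous d p}"
    then have keys: "Poly_Mapping.keys p \<subseteq> ?M" by (auto simp: mp_homogeneous_alt)
    have "mp_smult c (?mon m) = Poly_Mapping.single m c" for c and m :: "3 \<Rightarrow>\<^sub>0 nat"
      by (rule poly_mapping_eqI) (simp add: lookup_mp_smult lookup_single when_def)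
    then have "p = (\<Sum>m\<in>Poly_Mapping.keys p. mp_smult (Poly_Mapping.lookup p m) (?mon m))"
      by (simp add: sum_single_lookup)
    also have "\<dots> \<in> mp.span (?mon ` ?M)"
      using keys by (intro mp.span_sum mp.span_scale mp.span_base) auto
    finally show "p \<in> mp.span (?mon ` ?M)" .
  qed
qed

text \<open>
  The coordinate \<open>x\<^sub>3\<close> times the lines joining \<open>P\<^sub>1\<close> to the other points vanishes on \<open>S\<close>, although its
  polarization need not; this shows that the polarization is independent of the evaluations.
\<close>

definition star_normal :: "(nat \<Rightarrow> 'a::comm_ring_1 ^ 3) \<Rightarrow> nat \<Rightarrow> 'a ^ 3" where
  "star_normal v j = (if j = 1 then vector [0, 0, 1] else cross (v 1) (v j))"

text \<open>Forms that detect the \<open>d + 1\<close> annihilating functionals are adjoined to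
  \<open>B\<close>, and the enlarged independent set still consists of forms of degree
  \<open>d\<close>. The point \<open>q0\<close> lies on no line joining two of the points.\<close>

lemma card_cone_basis_le:
  fixes v :: "nat \<Rightarrow> 'a::field_char_0 ^ 3"
  assumes d: "odd d" "d \<ge> 2"
    and B: "finite B" "mp.independent B" "B \<subseteq> range (cone_at d v)"
    and q0: "\<And>i j. i \<in> {1..d} \<Longrightarrow> j \<in> {1..d} \<Longrightarrow> i \<noteq> j \<Longrightarrow> dot q0 (cross (v i) (v j)) \<noteq> 0"
    and star: "polarization d v (\<Prod>j\<in>{1..d}. lin (star_normal v j)) \<noteq> 0"
  shows "card B + d + 1 \<le> (d + 2) choose 2"
proof -
  define w0 where "w0 = (\<Prod>j\<in>{1..d}. lin (star_normal v j))"
  define other where "other i = (if i = 1 then 2 else 1 :: nat)" for i :: nat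
  have other: "other i \<in> {1..d}" "other i \<noteq> i" for i using d by (auto simp: other_def)
  \<comment> \<open>A cone with vertex \<open>q0\<close> whose line through point \<open>i\<close>
    is replaced by a second copy of the line through point \<open>other i\<close>. It keeps degree
    \<open>d\<close> and vanishes at all the points except point \<open>i\<close>.\<close>
  define w where "w i = (\<Prod>j\<in>{1..d}. lin (cross q0 (v (if j = i then other i else j))))" for i
  let ?K = "\<lambda>i. {p. mp_eval (($) (v i)) p = 0}"
  have "B \<subseteq> {p. polarization d v p = 0}" using B(3) polarization_cone_at[OF d(1)] by auto
  then have "mp.span B \<subseteq> {p. polarization d v p = 0}"
    by (rule mp.span_minimal) (rule subspace_polarization)
  then have "w0 \<notin> mp.span B" using star by (auto simp: w0_def)
  then have B0: "mp.independent (insert w0 B)" "w0 \<notin> B"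
    using B(2) mp.independent_insertI mp.span_base by blast+
  have w0: "mp_eval (($) (v i)) w0 = 0" if "i \<in> {1..d}" for i
  proof -
    \<comment> \<open>Factor \<open>i\<close> vanishes at point \<open>i\<close>; for point 1,
      through which all the star lines pass, the second factor serves.\<close>
    let ?j = "if i = 1 then 2 else i"
    have "?j \<in> {1..d}" using that d by auto
    moreover have "dot (v i) (star_normal v ?j) = 0"
      by (auto simp: star_normal_def dot_def algebra_simps)
    ultimately show ?thesis unfolding w0_def mp_eval_prod_lin by (intro prod_zero) auto
  qed
  \<comment> \<open>\<open>w0\<close> is adjoined before the \<open>w i\<close>: it lies in every
    \<open>?K i\<close>, whereas the polarization of the \<open>w i\<close> is not
    controlled.\<close>
  have "\<exists>B'. finite B' \<and> mp.independent B' \<and> card B' = card (insert w0 B) + card {1..d} \<and>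
      B' \<subseteq> insert w0 B \<union> w ` {1..d}"
  proof (rule independent_extend_dual[where K = ?K])
    fix i assume i: "i \<in> {1..d}"
    have "insert w0 B \<subseteq> ?K i" using w0[OF i] B(3) mp_eval_cone_at_point[OF i] by auto
    moreover have "w i \<notin> ?K i"
    proof -
      have "dot (v i) (cross q0 (v k)) \<noteq> 0" if "k \<in> {1..d}" "k \<noteq> i" for k
      proof -
        have "dot (v i) (cross q0 (v k)) = - dot q0 (cross (v i) (v k))"
          by (simp add: dot_def algebra_simps)
        then show ?thesis using q0[OF i that(1)] that(2) by simp
      qed
      then show ?thesis using other[of i] by (auto simp: w_def mp_eval_prod_lin)
    qed
    ultimately show "mp.subspace (?K i) \<and> insert w0 B \<subseteq> ?K i \<and> w i \<notin> ?K i"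
      using subspace_eval by blast
  next
    fix i j assume ij: "i \<in> {1..d}" "j \<in> {1..d}" "i \<noteq> j"
    have "dot (v i) (cross q0 (v i)) = 0" by (simp add: dot_def algebra_simps)
    then have "mp_eval (($) (v i)) (w j) = 0"
      unfolding w_def mp_eval_prod_lin using ij by (intro prod_zero) auto
    then show "w j \<in> ?K i" by simp
  qed (use B B0 in simp_all)
  then obtain B' where B': "finite B'" "mp.independent B'" "card B' = card (insert w0 B) + d"
    "B' \<subseteq> insert w0 B \<union> w ` {1..d}" by auto
  obtain T :: "(3, 'a) mpol set" where T: "finite T" "card T \<le> (d + 2) choose 2"
    "{p. mp_homogeneous d p} \<subseteq> mp.span T"
    using homogeneous_spanning_set by blast
  have "insert w0 B \<union> w ` {1..d} \<subseteq> {p. mp_homogeneous d p}"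
    using B(3) by (auto simp: w0_def w_def cone_at_def homogeneous_prod_lin[unfolded One_nat_def])
  then have "B' \<subseteq> mp.span T" using B'(4) T(3) by blast
  then have "card B' \<le> card T" using mp.independent_span_bound[OF T(1) B'(2)] by blast
  then show ?thesis using B' B B0 T by simp
qed

lemma dim_cone_space_le:
  fixes v :: "nat \<Rightarrow> 'a::field_char_0 ^ 3"
  assumes d: "d \<ge> 5" "d mod 4 = 1"
    and v: "\<And>i. i \<in> {1..d} \<Longrightarrow> v i \<in> P i \<and> v i \<noteq> 0"
    and q0: "\<And>i j. i \<in> {1..d} \<Longrightarrow> j \<in> {1..d} \<Longrightarrow> i \<noteq> j \<Longrightarrow> dot q0 (cross (v i) (v j)) \<noteq> 0"
    and star: "polarization d v (\<Prod>j\<in>{1..d}. lin (star_normal v j)) \<noteq> 0"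
  shows "int (mp.dim (cone_space d P)) \<le> int ((d + 2) choose 2) - int d - 2"
proof -
  define k where "k = d div 4"
  have k: "d = 4 * k + 1" using d div_mult_mod_eq[of d 4] by (simp add: k_def)
  have "odd d" by (simp add: k)
  \<comment> \<open>The basis is drawn from the cone forms themselves, since the parity argument
    needs a vertex for each element.\<close>
  obtain B where B: "B \<subseteq> range (cone_at d v)" "mp.independent B" "range (cone_at d v) \<subseteq> mp.span B"
    using mp.maximal_independent_subset[of "range (cone_at d v)"] by blast
  obtain T :: "(3, 'a) mpol set" where T: "finite T" "{p. mp_homogeneous d p} \<subseteq> mp.span T"
    using homogeneous_spanning_set by blast
  have "cone_at d v q \<in> mp.span T" for q
    using T(2) homogeneous_prod_lin[of d "\<lambda>i. cross (v i) q"] by (auto simp: cone_at_def)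
  then have "B \<subseteq> mp.span T" using B(1) by auto
  then have fin: "finite B" using mp.independent_span_bound[OF T(1) B(2)] by blast
  have nz: "cross (v i) (v j) \<noteq> 0" if "i \<in> {1..d}" "j \<in> {1..d}" "i \<noteq> j" for i j
  proof
    assume "cross (v i) (v j) = 0"
    then have "dot q0 (cross (v i) (v j)) = dot q0 0" by (rule arg_cong)
    then show False using q0[OF that] by (simp add: dot_def)
  qed
  have "cone_space d P \<subseteq> mp.span (range (cone_at d v))"
    unfolding cone_space_def
    using cone_polynomials_subset_span[of d v P, OF v nz] by (intro mp.span_minimal) simp_all
  also have "\<dots> \<subseteq> mp.span B" using B(3) by (intro mp.span_minimal) simp_all
  finally have le: "mp.dim (cone_space d P) \<le> card B" using fin by (rule mp.dim_le_card)
  have "even (card B)" using even_card_cone_basis[OF \<open>odd d\<close> fin B(2,1,3)] .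
  moreover have "card B + d + 1 \<le> (d + 2) choose 2"
    using card_cone_basis_le[OF \<open>odd d\<close> _ fin B(2,1) q0 star] d by simp
  \<comment> \<open>Here \<open>d + 2 = 4 * k + 3\<close>, so the binomial is a product of two odd
    numbers.\<close>
  moreover have "(d + 2) choose 2 = (4 * k + 3) * (2 * k + 1)"
    by (simp add: k choose_two algebra_simps)
  then have "odd ((d + 2) choose 2)" by simp
  \<comment> \<open>\<open>card B + d + 1\<close> is even and the binomial odd, so equality is
    impossible; this gains the last unit.\<close>
  ultimately have "card B + d + 2 \<le> (d + 2) choose 2"
    using k by (cases "card B + d + 1 = (d + 2) choose 2") (auto, presburger)
  then show ?thesis using le by linarith
qed

section \<open>Genericity\<close>

text \<open>The vector (1, 1, -1) plays the role of \<open>q0\<close>: nonvanishing means that this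
  point lies on no line joining two of the points, which are thereby distinct.\<close>

definition general_position_poly :: "nat \<Rightarrow> (nat \<times> 3, 'a::comm_ring_1) mpol" where
  "general_position_poly d = (\<Prod>p\<in>{p \<in> {1..d} \<times> {1..d}. fst p \<noteq> snd p}.
     bracket (\<lambda>k. Poly_Mapping.single 0 (vector [1, 1, -1] $ k)) (coord (fst p)) (coord (snd p)))"

text \<open>The permanent that gives the polarization of the star form, written in the coordinates
  of the points; for \<open>j = 1\<close> the linear form is the third coordinate.\<close>

definition star_poly :: "nat \<Rightarrow> (nat \<times> 3, 'a::comm_ring_1) mpol" where
  "star_poly d = (\<Sum>\<sigma> | \<sigma> permutes {1..d}. \<Prod>j\<in>{1..d}.
     if j = 1 then coord (\<sigma> j) 3 else bracket (coord (\<sigma> j)) (coord 1) (coord j))"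

lemma mp_eval_general_position_poly:
  "mp_eval (\<lambda>(i, j). v i $ j) (general_position_poly d) =
    (\<Prod>p\<in>{p \<in> {1..d} \<times> {1..d}. fst p \<noteq> snd p}.
      dot (vector [1, 1, -1]) (cross (v (fst p)) (v (snd p))))"
  unfolding general_position_poly_def mp_eval_prod
  by (simp add: mp_eval_bracket mp_eval_coord mp_eval_single dot_cross)

lemma mp_eval_star_poly:
  fixes v :: "nat \<Rightarrow> 'a::field ^ 3"
  shows "mp_eval (\<lambda>(i, j). v i $ j) (star_poly d) =
    polarization d v (\<Prod>j\<in>{1..d}. lin (star_normal v j))"
  unfolding star_poly_def mp_eval_prod mp_eval_sum polarization_prod_lin
  by (intro sum.cong prod.cong refl)
    (auto simp: mp_eval_bracket mp_eval_coord star_normal_def dot_cross, simp add: dot_def)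

lemma multihomogeneous_general_position_poly:
  "\<exists>e. multihomogeneous_deg d e (general_position_poly d :: (nat \<times> 3, 'a::comm_ring_1) mpol)"
  unfolding general_position_poly_def
proof (rule exI, rule multihomogeneous_deg_prod)
  fix p assume "p \<in> {p \<in> {1..d} \<times> {1..d}. fst p \<noteq> snd p}"
  then have p: "fst p \<in> {1..d}" "snd p \<in> {1..d}" by auto
  show "multihomogeneous_deg d (\<lambda>i. 0 + (of_bool (i = fst p) + of_bool (i = snd p)))
    (bracket (\<lambda>k. Poly_Mapping.single 0 (vector [1, 1, -1] $ k)) (coord (fst p)) (coord (snd p)) :: (nat \<times> 3, 'a) mpol)"
    by (intro multihomogeneous_deg_bracket multihomogeneous_deg_const multihomogeneous_deg_coord p)
qed

text \<open>As \<open>\<sigma>\<close> is a permutation, the indices \<open>\<sigma> j\<close>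
  contribute the same multidegree to every term, so the terms can be added.\<close>

lemma multihomogeneous_star_poly:
  "\<exists>e. multihomogeneous_deg d e (star_poly d :: (nat \<times> 3, 'a::comm_ring_1) mpol)"
proof (cases "d = 0")
  case True
  then show ?thesis by (auto simp: star_poly_def multihomogeneous_deg_def)
next
  case False
  let ?r = "\<lambda>(j :: nat) (i :: nat). if j = 1 then 0 else of_bool (i = 1) + of_bool (i = j) :: nat"
  let ?e = "\<lambda>i. (\<Sum>j\<in>{1..d}. of_bool (i = j) + ?r j i)"
  have "multihomogeneous_deg d ?e (\<Prod>j\<in>{1..d}.
     if j = 1 then coord (\<sigma> j) 3 else bracket (coord (\<sigma> j)) (coord 1) (coord j) :: (nat \<times> 3, 'a) mpol)"
    if \<sigma>: "\<sigma> permutes {1..d}" for \<sigma>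
  proof (rule multihomogeneous_deg_cong)
    have \<sigma>': "\<sigma> j \<in> {1..d}" if "j \<in> {1..d}" for j using permutes_in_image[OF \<sigma>] that by simp
    show "multihomogeneous_deg d (\<lambda>i. \<Sum>j\<in>{1..d}. of_bool (i = \<sigma> j) + ?r j i) (\<Prod>j\<in>{1..d}.
       if j = 1 then coord (\<sigma> j) 3 else bracket (coord (\<sigma> j)) (coord 1) (coord j) :: (nat \<times> 3, 'a) mpol)"
    proof (rule multihomogeneous_deg_prod)
      fix j assume j: "j \<in> {1..d}"
      show "multihomogeneous_deg d (\<lambda>i. of_bool (i = \<sigma> j) + ?r j i)
        (if j = 1 then coord (\<sigma> j) 3 else bracket (coord (\<sigma> j)) (coord 1) (coord j) :: (nat \<times> 3, 'a) mpol)"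
      proof (cases "j = 1")
        case True
        then show ?thesis using multihomogeneous_deg_coord[OF \<sigma>'[OF j]] by simp
      next
        case F: False
        have "multihomogeneous_deg d (\<lambda>i. of_bool (i = \<sigma> j) + (of_bool (i = 1) + of_bool (i = j)))
          (bracket (coord (\<sigma> j)) (coord 1) (coord j) :: (nat \<times> 3, 'a) mpol)"
          by (intro multihomogeneous_deg_bracket multihomogeneous_deg_coord \<sigma>' j) (use \<open>d \<noteq> 0\<close> in simp)
        then show ?thesis using F by simp
      qed
    qed
    have perm: "(\<Sum>j\<in>{1..d}. of_bool (i = \<sigma> j) :: nat) = (\<Sum>j\<in>{1..d}. of_bool (i = j))" for i
      using sum.permute[OF \<sigma>, of "\<lambda>j. of_bool (i = j) :: nat"] by (simp add: o_def)
    show "(\<Sum>j\<in>{1..d}. of_bool (i = \<sigma> j) + ?r j i) = ?e i" for i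
      unfolding sum.distrib perm ..
  qed
  then show ?thesis unfolding star_poly_def by (blast intro: multihomogeneous_deg_sum)
qed

section \<open>A tuple of points in the generic set\<close>

text \<open>
  A witness: with \<open>P\<^sub>1 = (0:0:1)\<close> and the other points alternating between two lines through
  \<open>P\<^sub>1\<close>, all nonzero terms of the permanent \<open>star_poly\<close> coincide.
\<close>

definition witness :: "nat \<Rightarrow> 'a::field_char_0 ^ 3" where
  "witness i = (if i = 1 then vector [0, 0, 1]
     else if even i then vector [1, 0, of_nat i] else vector [0, 1, of_nat i])"

lemma witness_nonzero: "witness i \<noteq> 0"
  by (auto simp: witness_def vec3_eq_iff)

text \<open>Up to sign the determinant is 1, \<open>i - j\<close> or \<open>i + j + 1\<close>, each
  nonzero in characteristic zero.\<close>

lemma witness_general_position: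
  assumes "i \<noteq> j"
  shows "dot (vector [1, 1, -1]) (cross (witness i) (witness j)) \<noteq> (0 :: 'a::field_char_0)"
proof -
  have "of_nat i + of_nat j + 1 = (of_nat (i + j + 1) :: 'a)" by simp
  also have "\<dots> \<noteq> 0" unfolding of_nat_eq_0_iff by simp
  finally show ?thesis
    using assms by (auto simp: witness_def dot_def algebra_simps eq_neg_iff_add_eq_0)
qed

text \<open>For a column \<open>j \<noteq> 1\<close>, the entry is zero if point \<open>i\<close>
  lies on the line joining points 1 and \<open>j\<close>, and otherwise a sign depending only on
  \<open>j\<close>. So a nonzero term needs \<open>\<sigma>\<close> to fix 1 and to exchange the
  parities on \<open>{2..d}\<close>; all such terms are equal, and the sum is a sign times their
  number.\<close>

lemma witness_star:
  assumes "odd d"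
  shows "polarization d (witness :: nat \<Rightarrow> 'a::field_char_0 ^ 3) (\<Prod>j\<in>{1..d}. lin (star_normal witness j)) \<noteq> 0"
proof -
  let ?v = "witness :: nat \<Rightarrow> 'a ^ 3"
  let ?s = "\<lambda>j :: nat. if j = 1 \<or> even j then 1 else -1 :: 'a"
  define good where "good \<sigma> \<longleftrightarrow> (\<forall>j\<in>{2..d}. \<sigma> j \<noteq> 1 \<and> (even (\<sigma> j) \<longleftrightarrow> odd j))" for \<sigma> :: "nat \<Rightarrow> nat"
  have entry: "dot (?v i) (star_normal ?v j) = (if i \<noteq> 1 \<and> (even i \<longleftrightarrow> odd j) then ?s j else 0)"
    if "j \<noteq> 1" for i j
    using that by (auto simp: witness_def dot_def star_normal_def)
  have "(\<Prod>j\<in>{1..d}. dot (?v (\<sigma> j)) (star_normal ?v j)) = (if good \<sigma> then \<Prod>j\<in>{1..d}. ?s j else 0)"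
    if \<sigma>: "\<sigma> permutes {1..d}" for \<sigma>
  proof (cases "good \<sigma>")
    case True
    \<comment> \<open>The value 1 is attained, but not on \<open>{2..d}\<close>, so
      \<open>\<sigma>\<close> fixes 1.\<close>
    have "1 \<in> \<sigma> ` {1..d}" using permutes_image[OF \<sigma>] assms odd_pos[of d] by auto
    then obtain j where j: "j \<in> {1..d}" "\<sigma> j = 1" by auto
    then have "j = 1" using True by (cases "j = 1") (auto simp: good_def)
    then have "\<sigma> 1 = 1" using j by simp
    then have "dot (?v (\<sigma> 1)) (star_normal ?v 1) = ?s 1"
      by (simp add: witness_def dot_def star_normal_def)
    then have "dot (?v (\<sigma> j)) (star_normal ?v j) = ?s j" if "j \<in> {1..d}" for j
      using that True entry[of j] by (cases "j = 1") (auto simp: good_def)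
    then have "(\<Prod>j\<in>{1..d}. dot (?v (\<sigma> j)) (star_normal ?v j)) = (\<Prod>j\<in>{1..d}. ?s j)"
      by (rule prod.cong[OF refl])
    then show ?thesis using True by simp
  next
    case False
    then obtain j where "j \<in> {2..d}" "\<not> (\<sigma> j \<noteq> 1 \<and> (even (\<sigma> j) \<longleftrightarrow> odd j))"
      by (auto simp: good_def)
    then have "j \<in> {1..d}" "dot (?v (\<sigma> j)) (star_normal ?v j) = 0"
      using entry[of j "\<sigma> j"] by auto
    then show ?thesis using False prod_zero[of "{1..d}" "\<lambda>j. dot (?v (\<sigma> j)) (star_normal ?v j)"] by auto
  qed
  then have "polarization d ?v (\<Prod>j\<in>{1..d}. lin (star_normal ?v j)) =
      (\<Sum>\<sigma> | \<sigma> permutes {1..d}. if good \<sigma> then \<Prod>j\<in>{1..d}. ?s j else 0)"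
    unfolding polarization_prod_lin by (intro sum.cong) auto
  also have "\<dots> = of_nat (card {\<sigma>. \<sigma> permutes {1..d} \<and> good \<sigma>}) * (\<Prod>j\<in>{1..d}. ?s j)"
    using finite_permutations[of "{1..d}"] by (simp flip: sum.inter_filter)
  also have "\<dots> \<noteq> 0"
  proof -
    \<comment> \<open>Exchanges 2 with 3, 4 with 5 and so on; oddness of \<open>d\<close> lets these
      pairs exhaust \<open>{2..d}\<close>.\<close>
    define \<tau> where "\<tau> j = (if j \<in> {2..d} then if even j then j + 1 else j - 1 else j)" for j
    have mem: "\<tau> j \<in> {2..d}" if "j \<in> {2..d}" for j
      using that assms by (cases "j = d"; auto simp: \<tau>_def elim!: oddE evenE)
    have invol: "\<tau> (\<tau> j) = j" for j
    proof (cases "j \<in> {2..d}")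
      case True
      with mem[OF True] show ?thesis by (cases "even j") (auto simp: \<tau>_def)
    next
      case False
      then have "\<tau> j = j" unfolding \<tau>_def by (rule if_not_P)
      then show ?thesis by simp
    qed
    have "\<tau> j = j" if "j \<notin> {1..d}" for j using that by (auto simp: \<tau>_def)
    then have "\<tau> permutes {1..d}" unfolding permutes_def using invol by metis
    moreover have "good \<tau>" by (auto simp: good_def \<tau>_def) presburger
    ultimately have "{\<sigma>. \<sigma> permutes {1..d} \<and> good \<sigma>} \<noteq> {}" by blast
    moreover have "finite {\<sigma>. \<sigma> permutes {1..d} \<and> good \<sigma>}"
      using finite_permutations[of "{1..d}"] by (rule rev_finite_subset) auto
    ultimately show ?thesis by (simp add: card_gt_0_iff)
  qed
  finally show ?thesis .
qed

section \<open>The bound for generic points\<close>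

lemma mp_eval_generic_poly_nonzero_iff:
  fixes v :: "nat \<Rightarrow> 'a::field ^ 3"
  shows "mp_eval (\<lambda>(i, j). v i $ j) (general_position_poly d * star_poly d) \<noteq> 0 \<longleftrightarrow>
    (\<forall>i\<in>{1..d}. \<forall>j\<in>{1..d}. i \<noteq> j \<longrightarrow> dot (vector [1, 1, -1]) (cross (v i) (v j)) \<noteq> 0) \<and>
    polarization d v (\<Prod>j\<in>{1..d}. lin (star_normal v j)) \<noteq> 0"
proof -
  have "finite {p \<in> {1..d} \<times> {1..d}. fst p \<noteq> snd p}" by simp
  then show ?thesis
    unfolding mp_eval_mult mp_eval_general_position_poly mp_eval_star_poly mult_eq_0_iff
      prod_zero_iff[OF \<open>finite _\<close>] by fastforce
qed

theorem theorem3p1: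
  fixes d :: nat
  assumes "d \<ge> 5" and "d mod 4 = 1"
  shows "holds_generically d (\<lambda>P :: nat \<Rightarrow> ('a::field_char_0 ^ 3) set.
           int (mp.dim (cone_space d P)) \<le> int ((d + 2) choose 2) - int d - 2)"
proof (rule holds_genericallyI)
  let ?f = "general_position_poly d * star_poly d :: (nat \<times> 3, 'a) mpol"
  obtain e e' where "multihomogeneous_deg d e (general_position_poly d :: (nat \<times> 3, 'a) mpol)"
    "multihomogeneous_deg d e' (star_poly d :: (nat \<times> 3, 'a) mpol)"
    using multihomogeneous_general_position_poly multihomogeneous_star_poly by blast
  then show "multihomogeneous d ?f"
    using multihomogeneous_degI multihomogeneous_deg_mult by blast
  let ?P0 = "\<lambda>i\<in>{1..d}. vec.span {witness i} :: ('a ^ 3) set"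
  show "?P0 \<in> plane_tuples d"
    unfolding plane_tuples_def using span_in_proj_plane[OF witness_nonzero] by auto
  have "odd d" using assms(2) by presburger
  then have "mp_eval (\<lambda>(i, j). witness i $ j) ?f \<noteq> 0"
    unfolding mp_eval_generic_poly_nonzero_iff using witness_general_position witness_star by blast
  moreover have "\<forall>i\<in>{1..d}. witness i \<in> ?P0 i \<and> (witness i :: 'a ^ 3) \<noteq> 0"
    using witness_nonzero by (auto simp: vec.span_base)
  ultimately show "\<not> vanishes_at_tuple d ?f ?P0"
    unfolding vanishes_at_tuple_def by blast
next
  fix P :: "nat \<Rightarrow> ('a ^ 3) set"
  assume "\<not> vanishes_at_tuple d (general_position_poly d * star_poly d) P"
  \<comment> \<open>The bound needs only one choice of representatives at which the polynomial is
    nonzero.\<close>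
  then obtain v where v: "\<forall>i\<in>{1..d}. v i \<in> P i \<and> v i \<noteq> 0"
    and nz: "mp_eval (\<lambda>(i, j). v i $ j) (general_position_poly d * star_poly d) \<noteq> 0"
    unfolding vanishes_at_tuple_def by blast
  show "int (mp.dim (cone_space d P)) \<le> int ((d + 2) choose 2) - int d - 2"
    using dim_cone_space_le[OF assms, of v P] v nz unfolding mp_eval_generic_poly_nonzero_iff by blast
qed

end
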